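(* Let $r\geq 2$ and $n,k_1,k_2,\dots,k_r$ be positive integers. Let $\mathcal F_1\subseteq\binom{[n]}{k_1},\mathcal F_2\subseteq\binom{[n]}{k_2},\dots,\mathcal F_r\subseteq\binom{[n]}{k_r}$ be non-empty cross-intersecting families with $k_1\geq k_2\geq\cdots\geq k_r$ and $n\geq k_1+k_2$. Then $$\sum_{i=1}^{r}|\mathcal F_i|\leq\max\left\{\binom{n}{k_1}-\binom{n-k_r}{k_1}+\sum_{i=2}^{r}\binom{n-k_r}{k_i-k_r},\ \sum_{i=1}^{r}\binom{n-1}{k_i-1}\right\}$$ with equality if and only if (1) if $n=k_1+k_r$, then (i) when $r=2$, $\mathcal F_{1}=\binom{[n]}{k_1}\setminus\overline{\mathcal F_{2}}$ and $0<|\mathcal F_{2}|<\binom{n}{k_{2}}$; (ii) when $r>2$ and $k_1>k_2=\cdots=k_r$, there exists $x\in[n]$ such that $\mathcal F_i=\{F\in\binom{[n]}{k_i}:x\in F\}$ for every $i\in[r]$; (iii) when $r>2$ and $k_1=k_{2}=\dots=k_{r}$, $\mathcal F_i=\mathcal F$ for every $i\in[r]$, where $\mathcal F\subseteq\binom{[n]}{k_1}$ is an intersecting family with $|\mathcal F|=\binom{n-1}{k_1-1}$; (2) if $n>k_1+k_r$, then either there exists $x\in[n]$ such that $\mathcal F_{i}=\{F\in\binom{[n]}{k_i}:x\in F\}$ for every $i\in[r]$, or there exists $S\in\binom{[n]}{k_r}$ such that $\mathcal F_{j}=\{F\in\binom{[n]}{k_{j}}:F\cap S\neq\emptyset\}$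 for some $j\in[r]$ with $k_j=k_1$ and $\mathcal F_i=\{F\in\binom{[n]}{k_i}:S\subseteq F\}$ for every $i\in[r]\setminus\{j\}$.
   Context: $[n]=\{1,2,\dots,n\}$ and $\binom{[n]}{k}$ is the family of all $k$-element subsets of $[n]$. Families $\mathcal F_1\subseteq\binom{[n]}{k_1},\dots,\mathcal F_r\subseteq\binom{[n]}{k_r}$ are cross-intersecting if $|F_i\cap F_j|\geq 1$ for all $1\leq i<j\leq r$ and all $F_i\in\mathcal F_i$, $F_j\in\mathcal F_j$; they are non-empty if $\mathcal F_i\neq\emptyset$ for every $i\in[r]$. A family $\mathcal F$ is intersecting if $|F\cap F'|\geq 1$ for all $F,F'\in\mathcal F$. For a family $\mathcal F$ of subsets of $[n]$, $\overline{\mathcal F}=\{[n]\setminus F:F\in\mathcal F\}$.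
   Formalization: In (2) each configuration is required to be one whose total attains the maximum (common star: second term ≥ first; S-configuration: first ≥ second); otherwise "if" fails, e.g. n=6, r=2, k=(3,2): common stars total 15 < 17. *)

theory Defs
  imports Complex_Main "HOL-Library.Ramsey"
begin

text \<open>
  The set \<open>[n]\<close> is \<open>{1..n}\<close>, and the family of its \<open>k\<close>-element subsets is
  \<^term>\<open>nsets {1..n} k\<close>. A sequence of \<open>r\<close> families is a function on \<open>nat\<close> of which only
  the values at \<open>1, \<dots>, r\<close> are used.
\<close>

definition cross_intersecting :: "nat \<Rightarrow> (nat \<Rightarrow> nat set set) \<Rightarrow> bool" where
  "cross_intersecting r F \<longleftrightarrow>
     (\<forall>i\<in>{1..r}. \<forall>j\<in>{1..r}. i < j \<longrightarrow> (\<forall>A\<in>F i. \<forall>B\<in>F j. card (A \<inter> B) \<ge> 1))"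

definition intersecting :: "nat set set \<Rightarrow> bool" where
  "intersecting G \<longleftrightarrow> (\<forall>A\<in>G. \<forall>B\<in>G. card (A \<inter> B) \<ge> 1)"

definition complement_family :: "nat \<Rightarrow> nat set set \<Rightarrow> nat set set" where
  "complement_family n G = (\<lambda>A. {1..n} - A) ` G"

text \<open>
  The two terms of the maximum. No subtraction on \<open>nat\<close> is truncated when
  \<open>1 \<le> k r \<le> k i\<close> for all \<open>i\<close> in \<open>{1..r}\<close> and \<open>k r \<le> n\<close>.
\<close>

definition hitting_bound :: "nat \<Rightarrow> nat \<Rightarrow> (nat \<Rightarrow> nat) \<Rightarrow> nat" where
  "hitting_bound n r k =
     (n choose k 1) - ((n - k r) choose k 1) + (\<Sum>i=2..r. (n - k r) choose (k i - k r))"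

definition star_bound :: "nat \<Rightarrow> nat \<Rightarrow> (nat \<Rightarrow> nat) \<Rightarrow> nat" where
  "star_bound n r k = (\<Sum>i=1..r. (n - 1) choose (k i - 1))"

text \<open>
  \<open>is_star\<close>: all the families are full stars with one common centre.
  \<open>is_hitting\<close>: for some \<open>k r\<close>-set \<open>S\<close>, one family of largest uniformity consists of all sets
  meeting \<open>S\<close>, and each of the others consists of all sets containing \<open>S\<close>.
\<close>

definition is_star :: "nat \<Rightarrow> nat \<Rightarrow> (nat \<Rightarrow> nat) \<Rightarrow> (nat \<Rightarrow> nat set set) \<Rightarrow> bool" where
  "is_star n r k F \<longleftrightarrow>
     (\<exists>x\<in>{1..n}. \<forall>i\<in>{1..r}. F i = {A \<in> nsets {1..n} (k i). x \<in> A})"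

definition is_hitting :: "nat \<Rightarrow> nat \<Rightarrow> (nat \<Rightarrow> nat) \<Rightarrow> (nat \<Rightarrow> nat set set) \<Rightarrow> bool" where
  "is_hitting n r k F \<longleftrightarrow>
     (\<exists>S\<in>nsets {1..n} (k r). \<exists>j\<in>{1..r}. k j = k 1 \<and>
        F j = {A \<in> nsets {1..n} (k j). A \<inter> S \<noteq> {}} \<and>
        (\<forall>i\<in>{1..r} - {j}. F i = {A \<in> nsets {1..n} (k i). S \<subseteq> A}))"

end

theory Submission
  imports Defs
begin

text \<open>
  If no two distinct indices have \<open>k a + k b < n\<close>, then \<open>r = 2\<close> or all uniformities equal \<open>n / 2\<close>,
  and one counts sets together with their complements.

  Otherwise, apply Bollobas--Leader compressions to all families at once, always for a pair
  \<open>(U, V)\<close> with \<open>U\<close> as small as possible. This keeps the families cross-intersecting, and it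
  makes a tuple of stars only out of a tuple of stars. In the resulting families, a member that contains
  \<open>[d]\<close> but not \<open>d + 1\<close> forces all sets that contain \<open>[d + 1]\<close> into the family, so that at most
  one family, the \<open>j\<close>-th, leaves the star of \<open>1\<close>. If \<open>[d]\<close> is the longest initial segment common
  to all members of the others, then regularity of the bipartite disjointness graph bounds the total
  by a convex combination of the values \<open>h d\<close> and \<open>h (d + 1)\<close>, where \<open>h d\<close> is the total for the
  families of sets meeting \<open>[d]\<close>, respectively containing \<open>[d]\<close>. As \<open>h\<close> has no interior maximum,
  only \<open>h 1\<close>, the star bound, and the value at the least of the other uniformities remain.
\<close>

subsection \<open>Sets of fixed size and the disjointness graph\<close>

text \<open>Shifts of single elements would not suffice: to force all sets through
  \<open>[d + 1]\<close> into a family, sets that differ in many points must be exchanged in one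
  move, so pairs of every size are compressed. A compression with a large \<open>U\<close> may
  destroy cross-intersection by itself; stability of all the families under the smaller pairs
  prevents this, whence the choice of \<open>U\<close>. The two extremal shapes are recovered
  differently. A hitting configuration can be read off from the cardinalities, which compressions
  preserve. Stars cannot: when \<open>k i + k j = n\<close>, other cross-intersecting pairs can have
  the same sizes. So being a tuple of stars is traced back through every compression, and this uses
  a pair of indices with \<open>k a + k b < n\<close>, that is, one spare point. The spare point
  also makes the estimate in the disjointness graph strict, which settles the case that
  \<open>h d\<close> and \<open>h (d + 1)\<close> are both maximal. The weight of
  \<open>h (d + 1)\<close> in the convex combination is the share of the \<open>j\<close>-th family
  among the sets that contain \<open>d + 1\<close> and avoid \<open>[d]\<close>.\<close>

abbreviation cross :: "'a set set \<Rightarrow> 'a set set \<Rightarrow> bool" where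
  "cross \<A> \<B> \<equiv> \<forall>A\<in>\<A>. \<forall>B\<in>\<B>. A \<inter> B \<noteq> {}"

abbreviation star :: "nat \<Rightarrow> nat \<Rightarrow> nat \<Rightarrow> nat set set" where
  "star n k x \<equiv> {A \<in> nsets {1..n} k. x \<in> A}"

lemma nsets_iff: "finite W \<Longrightarrow> A \<in> nsets W k \<longleftrightarrow> A \<subseteq> W \<and> card A = k"
  by (auto simp: nsets_def dest: finite_subset)

lemma nsets_between:
  assumes "finite W" "T \<subseteq> W" "card T \<le> k" "k \<le> card W"
  obtains A where "A \<in> nsets W k" "T \<subseteq> A"
proof -
  have "k - card T \<le> card (W - T)"
    using assms by (simp add: card_Diff_subset finite_subset)
  then obtain R where R: "R \<subseteq> W - T" "card R = k - card T" "finite R"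
    by (rule obtain_subset_with_card_n)
  moreover have "card (T \<union> R) = k"
    using R assms by (subst card_Un_disjoint) (auto dest: finite_subset)
  ultimately show thesis
    using that[of "T \<union> R"] assms by (auto simp: nsets_iff)
qed

lemma card_nsets_superset:
  assumes "finite W" "T \<subseteq> W" "card T \<le> k"
  shows "card {A \<in> nsets W k. T \<subseteq> A} = (card W - card T) choose (k - card T)"
proof -
  have fT: "finite T" using assms finite_subset by blast
  have "bij_betw (\<lambda>A. A - T) {A \<in> nsets W k. T \<subseteq> A} (nsets (W - T) (k - card T))"
  proof (rule bij_betwI[where g = "\<lambda>B. B \<union> T"])
    show "(\<lambda>A. A - T) \<in> {A \<in> nsets W k. T \<subseteq> A} \<rightarrow> nsets (W - T) (k - card T)"
      using assms fT by (auto simp: nsets_iff card_Diff_subset)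
    show "(\<lambda>B. B \<union> T) \<in> nsets (W - T) (k - card T) \<rightarrow> {A \<in> nsets W k. T \<subseteq> A}"
    proof
      fix B assume "B \<in> nsets (W - T) (k - card T)"
      then have B: "B \<subseteq> W - T" "card B = k - card T" "finite B" by (auto simp: nsets_def)
      then have "card (B \<union> T) = k" using fT assms(3) by (subst card_Un_disjoint) auto
      then show "B \<union> T \<in> {A \<in> nsets W k. T \<subseteq> A}" using B assms by (auto simp: nsets_iff)
    qed
  qed (auto simp: nsets_def)
  then show ?thesis
    using bij_betw_same_card[of "\<lambda>A. A - T"] assms fT by (simp add: card_Diff_subset)
qed

lemma card_nsets_disjoint:
  assumes "finite W" "T \<subseteq> W"
  shows "card {A \<in> nsets W k. A \<inter> T = {}} = (card W - card T) choose k"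
proof -
  have "{A \<in> nsets W k. A \<inter> T = {}} = nsets (W - T) k" by (auto simp: nsets_def)
  then show ?thesis using assms by (simp add: card_Diff_subset finite_subset)
qed

lemma card_nsets_disjoint_nset:
  "finite W \<Longrightarrow> X \<in> nsets W a \<Longrightarrow> card {Y \<in> nsets W b. Y \<inter> X = {}} = (card W - a) choose b"
  using card_nsets_disjoint[of W X b] by (simp add: nsets_def)

lemma card_nsets_meeting:
  assumes "finite W" "T \<subseteq> W"
  shows "card {A \<in> nsets W k. A \<inter> T \<noteq> {}} + ((card W - card T) choose k) = card W choose k"
proof -
  have fin: "finite (nsets W k)" using assms finite_imp_finite_nsets by blast
  have "nsets W k = {A \<in> nsets W k. A \<inter> T \<noteq> {}} \<union> {A \<in> nsets W k. A \<inter> T = {}}" by blast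
  then have "card (nsets W k) = card {A \<in> nsets W k. A \<inter> T \<noteq> {}} + card {A \<in> nsets W k. A \<inter> T = {}}"
    using fin by (subst card_Un_disjoint[symmetric]) auto
  then show ?thesis using card_nsets_disjoint[OF assms, of k] by simp
qed

lemma card_star: "x \<in> {1..n} \<Longrightarrow> 1 \<le> k \<Longrightarrow> card (star n k x) = (n - 1) choose (k - 1)"
  using card_nsets_superset[of "{1..n}" "{x}" k] by simp

text \<open>Exchanging one element at a time leads from \<open>X\<close> to \<open>Y\<close>, and
  some exchange leaves \<open>P\<close>. This serves strictness: the two sets found occupy at most
  \<open>a + 1\<close> points together, so one spare point is enough for a single set to avoid
  both.\<close>

lemma nsets_adjacent_pair:
  assumes "finite W" "P \<subseteq> nsets W a" "X \<in> P" "Y \<in> nsets W a - P"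
  obtains X' Y' where "X' \<in> P" "Y' \<in> nsets W a - P" "card (X' \<union> Y') \<le> Suc a"
proof -
  have "\<exists>X'\<in>P. \<exists>Y'\<in>nsets W a - P. card (X' \<union> Y') \<le> Suc a"
    using assms(3)
  proof (induction "card (Y - X)" arbitrary: X rule: less_induct)
    case less
    have X: "X \<in> nsets W a" using less.prems assms(2) by blast
    then have fX: "finite X" "card X = a" "X \<subseteq> W" by (auto simp: nsets_def)
    have fY: "finite Y" "card Y = a" "Y \<subseteq> W" using assms(4) by (auto simp: nsets_def)
    show ?case
    proof (cases "card (Y - X) \<le> 1")
      case True
      have "card (X \<union> Y) = card X + card (Y - X)"
        using fX fY card_Un_disjoint[of X "Y - X"] by (simp add: Un_Diff_cancel)
      then show ?thesis using True less.prems assms(4) fX by (intro bexI[of _ X] bexI[of _ Y]) auto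
    next
      case False
      then have "Y - X \<noteq> {}" by (intro notI) simp
      then obtain y where y: "y \<in> Y - X" by blast
      have "card (X - Y) = card (Y - X)"
        using fX fY by (simp add: card_Diff_subset_Int Int_commute)
      then have "X - Y \<noteq> {}" using False by (intro notI) simp
      then obtain x where x: "x \<in> X - Y" by blast
      define X2 where "X2 = insert y (X - {x})"
      have cX2: "card X2 = a" unfolding X2_def using fX x y
        by (metis Diff_iff card.remove card_insert_disjoint finite_Diff)
      have X2: "X2 \<in> nsets W a" using cX2 fX fY y assms(1) by (auto simp: nsets_iff X2_def)
      show ?thesis
      proof (cases "X2 \<in> P")
        case True
        have "Y - X2 \<subset> Y - X" using x y by (auto simp: X2_def)
        then have "card (Y - X2) < card (Y - X)" using fY by (intro psubset_card_mono) auto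
        then show ?thesis using less.hyps True by blast
      next
        case False
        have "X \<union> X2 = insert y X" using x y by (auto simp: X2_def)
        then have "card (X \<union> X2) \<le> Suc a" using fX by (simp add: card_insert_if)
        then show ?thesis using False X2 less.prems by (intro bexI[of _ X] bexI[of _ X2]) auto
      qed
    qed
  qed
  then show thesis using that by blast
qed

text \<open>Both sides count the disjoint pairs of an \<open>a\<close>-set and a
  \<open>b\<close>-set in an \<open>N\<close>-set. The identity relates the two degrees of the
  disjointness graph.\<close>

lemma choose_mult_disjoint: "(N choose a) * ((N - a) choose b) = (N choose b) * ((N - b) choose a)"
proof -
  let ?W = "{0..<N}"
  have *: "(\<Sum>X\<in>nsets ?W a. card {Y \<in> nsets ?W b. Y \<inter> X = {}}) =
      (\<Sum>Y\<in>nsets ?W b. card {X \<in> nsets ?W a. X \<inter> Y = {}})"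
    using sum.swap_restrict[of "nsets ?W a" "nsets ?W b" "\<lambda>_ _. 1::nat" "\<lambda>X Y. Y \<inter> X = {}"]
    by (simp add: finite_imp_finite_nsets Int_commute)
  have "(\<Sum>X\<in>nsets ?W a. card {Y \<in> nsets ?W b. Y \<inter> X = {}}) = (\<Sum>X\<in>nsets ?W a. (N - a) choose b)"
    by (intro sum.cong) (simp_all add: card_nsets_disjoint_nset)
  moreover have "(\<Sum>Y\<in>nsets ?W b. card {X \<in> nsets ?W a. X \<inter> Y = {}}) = (\<Sum>X\<in>nsets ?W b. (N - b) choose a)"
    by (intro sum.cong) (simp_all add: card_nsets_disjoint_nset)
  ultimately show ?thesis using * by simp
qed

text \<open>All neighbours of a member of \<open>\<B>\<close> in the disjointness graph lie outside
  \<open>\<A>\<close>, so the edges at \<open>\<B>\<close> are among the edges at the complement of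
  \<open>\<A>\<close>. An edge between the two complements is not counted at \<open>\<B>\<close>,
  which gives the strict form.\<close>

lemma cross_pair_edges:
  assumes W: "finite W" "card W = N" and AB: "\<A> \<subseteq> nsets W a" "\<B> \<subseteq> nsets W b" "cross \<A> \<B>"
  shows "card \<B> * ((N - b) choose a) \<le> ((N choose a) - card \<A>) * ((N - a) choose b)"
    and "Y \<in> nsets W b - \<B> \<Longrightarrow> X \<in> nsets W a - \<A> \<Longrightarrow> X \<inter> Y = {} \<Longrightarrow>
      card \<B> * ((N - b) choose a) < ((N choose a) - card \<A>) * ((N - a) choose b)"
proof -
  let ?C = "nsets W a - \<A>"
  let ?e = "\<lambda>Y. card {X \<in> ?C. X \<inter> Y = {}}"
  have fin: "finite (nsets W a)" "finite (nsets W b)" "finite \<A>" "finite \<B>"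
    using W AB finite_imp_finite_nsets finite_subset by metis+
  have cC: "card ?C = (N choose a) - card \<A>" using fin AB W by (simp add: card_Diff_subset)
  have "(\<Sum>X\<in>?C. card {Y \<in> nsets W b. Y \<inter> X = {}}) = (\<Sum>Y\<in>nsets W b. ?e Y)"
    using sum.swap_restrict[of ?C "nsets W b" "\<lambda>_ _. 1::nat" "\<lambda>X Y. Y \<inter> X = {}"] fin
    by (simp add: Int_commute)
  moreover have "(\<Sum>X\<in>?C. card {Y \<in> nsets W b. Y \<inter> X = {}}) = (\<Sum>X\<in>?C. (N - a) choose b)"
    using W by (intro sum.cong) (auto simp: card_nsets_disjoint_nset)
  ultimately have tot: "((N choose a) - card \<A>) * ((N - a) choose b) = (\<Sum>Y\<in>nsets W b. ?e Y)"
    using cC by simp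
  also have "\<dots> = (\<Sum>Y\<in>\<B>. ?e Y) + (\<Sum>Y\<in>nsets W b - \<B>. ?e Y)"
    using fin AB by (subst sum.subset_diff[of \<B>]) auto
  also have "(\<Sum>Y\<in>\<B>. ?e Y) = (\<Sum>Y\<in>\<B>. (N - b) choose a)"
  proof (intro sum.cong refl)
    fix Y assume Y: "Y \<in> \<B>"
    then have "{X \<in> ?C. X \<inter> Y = {}} = {X \<in> nsets W a. X \<inter> Y = {}}" using AB by blast
    moreover have "Y \<subseteq> W" "card Y = b" using Y AB by (auto simp: nsets_def)
    ultimately show "?e Y = (N - b) choose a" using W card_nsets_disjoint by metis
  qed
  finally have eq: "((N choose a) - card \<A>) * ((N - a) choose b) =
      card \<B> * ((N - b) choose a) + (\<Sum>Y\<in>nsets W b - \<B>. ?e Y)" by simp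
  then show "card \<B> * ((N - b) choose a) \<le> ((N choose a) - card \<A>) * ((N - a) choose b)" by simp
  assume "Y \<in> nsets W b - \<B>" "X \<in> nsets W a - \<A>" "X \<inter> Y = {}"
  then have "?e Y > 0" "Y \<in> nsets W b - \<B>" using fin by (auto simp: card_gt_0_iff)
  then have "(\<Sum>Y\<in>nsets W b - \<B>. ?e Y) > 0" using fin by (intro sum_pos2[of _ Y]) auto
  then show "card \<B> * ((N - b) choose a) < ((N choose a) - card \<A>) * ((N - a) choose b)"
    using eq by simp
qed

text \<open>In proportions: the shares of \<open>\<A>\<close> and \<open>\<B>\<close> in their
  levels add up to at most 1, and to less if a point is spare and both are non-empty. The degrees in
  \<open>cross_pair_edges\<close> cancel by \<open>choose_mult_disjoint\<close>.\<close>

lemma cross_pair_bound: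
  assumes W: "finite W" "card W = N" and AB: "\<A> \<subseteq> nsets W a" "\<B> \<subseteq> nsets W b" "cross \<A> \<B>"
    and N: "a + b \<le> N"
  shows "card \<B> * (N choose a) \<le> ((N choose a) - card \<A>) * (N choose b)"
    and "a + b < N \<Longrightarrow> \<A> \<noteq> {} \<Longrightarrow> \<B> \<noteq> {} \<Longrightarrow>
      card \<B> * (N choose a) < ((N choose a) - card \<A>) * (N choose b)"
proof -
  let ?c = "(N - a) choose b"
  have pos: "?c > 0" "N choose b > 0" using N by simp_all
  have *: "(card \<B> * (N choose a)) * ?c = (N choose b) * (card \<B> * ((N - b) choose a))"
    using choose_mult_disjoint[of N a b] by (simp add: algebra_simps)
  have "(card \<B> * (N choose a)) * ?c \<le> (((N choose a) - card \<A>) * (N choose b)) * ?c"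
    unfolding * using mult_left_mono[OF cross_pair_edges(1)[OF W AB], of "N choose b"]
    by (simp add: mult_ac)
  then show "card \<B> * (N choose a) \<le> ((N choose a) - card \<A>) * (N choose b)"
    using pos by simp
  assume lt: "a + b < N" and ne: "\<A> \<noteq> {}" "\<B> \<noteq> {}"
  obtain B where B: "B \<in> \<B>" using ne by blast
  obtain A where A: "A \<in> \<A>" using ne by blast
  have "card (W - B) = N - b" using B AB W
    by (auto simp: nsets_def card_Diff_subset subset_iff)
  then have "nsets (W - B) a \<noteq> {}" using N by (auto simp: nsets_eq_empty_iff)
  then obtain X where X: "X \<in> nsets (W - B) a" by blast
  then have "X \<inter> B = {}" by (auto simp: nsets_def)
  then have "X \<in> nsets W a - \<A>" using X B AB(3) nsets_mono[of "W - B" W a] by blast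
  then obtain X' Y' where XY: "X' \<in> \<A>" "Y' \<in> nsets W a - \<A>" "card (X' \<union> Y') \<le> Suc a"
    using nsets_adjacent_pair[OF W(1) AB(1) A] by blast
  have sub: "X' \<union> Y' \<subseteq> W" using XY AB by (auto simp: nsets_def)
  \<comment> \<open>\<open>D\<close> will avoid a member and a non-member of \<open>\<A>\<close> at
    once: the member keeps \<open>D\<close> out of \<open>\<B>\<close>, and the non-member then
    gives an edge between the two complements.\<close>
  then have "card (W - (X' \<union> Y')) \<ge> b" using XY W lt
    by (subst card_Diff_subset) (auto dest: finite_subset)
  then have "nsets (W - (X' \<union> Y')) b \<noteq> {}" by (auto simp: nsets_eq_empty_iff)
  then obtain D where D: "D \<in> nsets (W - (X' \<union> Y')) b" by blast
  have "D \<inter> X' = {}" "Y' \<inter> D = {}" using D by (auto simp: nsets_def)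
  moreover have "D \<in> nsets W b" using D nsets_mono[of "W - (X' \<union> Y')" W b] by blast
  ultimately have "D \<in> nsets W b - \<B>" "Y' \<inter> D = {}" using XY(1) AB(3) by blast+
  then have "card \<B> * ((N - b) choose a) < ((N choose a) - card \<A>) * ((N - a) choose b)"
    using cross_pair_edges(2)[OF W AB] XY by blast
  then have "(card \<B> * (N choose a)) * ?c < (((N choose a) - card \<A>) * (N choose b)) * ?c"
    unfolding * using pos by (simp add: mult_ac)
  then show "card \<B> * (N choose a) < ((N choose a) - card \<A>) * (N choose b)"
    using pos by simp
qed

subsection \<open>Compressions\<close>

definition move :: "'a set \<Rightarrow> 'a set \<Rightarrow> 'a set \<Rightarrow> 'a set" where
  "move U V A = (if V \<subseteq> A \<and> U \<inter> A = {} then (A - V) \<union> U else A)"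

definition compress :: "'a set \<Rightarrow> 'a set \<Rightarrow> 'a set set \<Rightarrow> 'a set set" where
  "compress U V \<A> = (\<lambda>A. if move U V A \<in> \<A> then A else move U V A) ` \<A>"

text \<open>For disjoint sets of equal size, \<open>Min U < Min V\<close> says that \<open>U\<close>
  precedes \<open>V\<close> lexicographically, so a move brings a set forward in this order.\<close>

definition lex_pair :: "nat set \<Rightarrow> nat set \<Rightarrow> nat set \<Rightarrow> bool" where
  "lex_pair W U V \<longleftrightarrow> U \<subseteq> W \<and> V \<subseteq> W \<and> finite W \<and> U \<noteq> {} \<and> V \<noteq> {} \<and> U \<inter> V = {} \<and>
     card U = card V \<and> Min U < Min V"

definition compressed :: "nat set \<Rightarrow> nat set set \<Rightarrow> bool" where
  "compressed W \<A> \<longleftrightarrow> (\<forall>U V. lex_pair W U V \<longrightarrow> (\<forall>A\<in>\<A>. move U V A \<in> \<A>))"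

lemma lex_pairD:
  assumes "lex_pair W U V"
  shows "U \<subseteq> W" "V \<subseteq> W" "finite U" "finite V" "U \<noteq> {}" "V \<noteq> {}" "U \<inter> V = {}" "card U = card V"
    "Min U < Min V" "finite W"
  using assms finite_subset[of U W] finite_subset[of V W] by (auto simp: lex_pair_def)

lemma move_move: "U \<noteq> {} \<Longrightarrow> U \<inter> V = {} \<Longrightarrow> move U V (move U V A) = move U V A"
  by (auto simp: move_def)

lemma move_in_nsets:
  assumes "lex_pair W U V" "A \<in> nsets W k"
  shows "move U V A \<in> nsets W k"
proof (cases "V \<subseteq> A \<and> U \<inter> A = {}")
  case True
  note P = lex_pairD[OF assms(1)]
  have A: "A \<subseteq> W" "finite A" "card A = k" using assms by (auto simp: nsets_def)
  have "card ((A - V) \<union> U) = card (A - V) + card U"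
    using A P True by (intro card_Un_disjoint) auto
  also have "\<dots> = k" using A P True card_mono[of A V] by (simp add: card_Diff_subset)
  finally show ?thesis using True A P by (auto simp: move_def nsets_def)
next
  case False then show ?thesis using assms by (auto simp: move_def)
qed

lemma compress_in_nsets: "lex_pair W U V \<Longrightarrow> \<A> \<subseteq> nsets W k \<Longrightarrow> compress U V \<A> \<subseteq> nsets W k"
  using move_in_nsets by (fastforce simp: compress_def)

text \<open>The image of a kept set lies in the family and that of a moved set does not; a moved set
  is restored by exchanging \<open>U\<close> for \<open>V\<close> again.\<close>

lemma inj_on_compress:
  assumes "U \<inter> V = {}"
  shows "inj_on (\<lambda>A. if move U V A \<in> \<A> then A else move U V A) \<A>"
proof (rule inj_onI, goal_cases)
  case (1 A B)
  have "A = B" if "move U V A = move U V B" "move U V A \<noteq> A" "move U V B \<noteq> B" for A B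
  proof -
    from that have m: "V \<subseteq> A" "U \<inter> A = {}" "V \<subseteq> B" "U \<inter> B = {}" "A - V \<union> U = B - V \<union> U"
      by (auto simp: move_def split: if_splits)
    have "A = ((A - V \<union> U) - U) \<union> V" "B = ((B - V \<union> U) - U) \<union> V" using m(1-4) assms by auto
    then show ?thesis using m(5) by simp
  qed
  then show ?case using 1 by (metis (full_types))
qed

lemma card_compress: "U \<inter> V = {} \<Longrightarrow> card (compress U V \<A>) = card \<A>"
  unfolding compress_def by (rule card_image[OF inj_on_compress])

lemma mem_compress_iff:
  "A \<in> compress U V \<A> \<longleftrightarrow> A \<in> \<A> \<and> move U V A \<in> \<A> \<or> A \<notin> \<A> \<and> (\<exists>B\<in>\<A>. A = move U V B)"
  by (auto simp: compress_def)

lemma move_in_compress: "A \<in> \<A> \<Longrightarrow> U \<noteq> {} \<Longrightarrow> U \<inter> V = {} \<Longrightarrow> move U V A \<in> compress U V \<A>"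
  by (auto simp: mem_compress_iff move_move)

text \<open>If \<open>A\<close> is moved and \<open>B\<close> is not although it meets \<open>V\<close>, a smaller pair
  that leaves an element of \<open>V - B\<close> in place already separates \<open>A\<close> from \<open>B\<close>.\<close>

lemma moved_meets:
  assumes P: "lex_pair W U V"
    and small: "\<And>U' V'. lex_pair W U' V' \<Longrightarrow> card U' < card U \<Longrightarrow>
      (\<forall>A\<in>\<A>. move U' V' A \<in> \<A>)"
    and X: "cross \<A> \<B>" and A: "A \<in> \<A>" "V \<subseteq> A" "U \<inter> A = {}"
    and B: "B \<in> \<B>" "move U V B \<in> \<B>"
  shows "move U V A \<inter> B \<noteq> {}"
proof
  assume "move U V A \<inter> B = {}"
  then have dis: "((A - V) \<union> U) \<inter> B = {}" using A by (simp add: move_def)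
  note P' = lex_pairD[OF P]
  show False
  proof (cases "V \<subseteq> B")
    \<comment> \<open>Here \<open>B\<close> can be moved as well, and its image, a member of
      \<open>\<B>\<close>, would be disjoint from \<open>A\<close>.\<close>
    case True
    moreover have "U \<inter> B = {}" using dis by blast
    ultimately have "(B - V) \<union> U \<in> \<B>" using B by (simp add: move_def)
    then have "A \<inter> ((B - V) \<union> U) \<noteq> {}" using A X by blast
    then show False using A dis by blast
  next
    case False
    then obtain v where v: "v \<in> V" "v \<notin> B" by blast
    have "A \<inter> B \<noteq> {}" using A B X by blast
    then have "B \<inter> (V - {v}) \<noteq> {}" using dis v by blast
    then have V': "V - {v} \<noteq> {}" by blast
    have "U \<noteq> {Min U}"
    proof
      assume "U = {Min U}"
      then have "card V = 1" using P'(8) by (metis card.empty card_insert_disjoint One_nat_def finite.emptyI empty_iff)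
      then have "V = {v}" using v(1) by (metis card_1_singletonE singletonD)
      then show False using V' by simp
    qed
    \<comment> \<open>Dropping a point other than \<open>Min U\<close> preserves
      \<open>Min U < Min V\<close>, whichever \<open>v\<close> is dropped from \<open>V\<close>.
      Since \<open>v\<close> is outside \<open>B\<close>, leaving it in place creates no common
      point.\<close>
    then obtain u where u: "u \<in> U" "u \<noteq> Min U" using P'(5) by blast
    have "Min (U - {u}) \<le> Min U" using P' u by (intro Min_le) auto
    moreover have "Min V \<le> Min (V - {v})" using P' V' by (intro Min_antimono) auto
    ultimately have "Min (U - {u}) < Min (V - {v})" using P'(9) by linarith
    moreover have "Min U \<in> U - {u}" using P'(3,5) u by simp
    moreover have "card (U - {u}) = card (V - {v})" using P'(8) u(1) v(1) by simp
    ultimately have "lex_pair W (U - {u}) (V - {v})"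
      using P'(1,2,7,10) V' unfolding lex_pair_def by blast
    moreover have "card (U - {u}) < card U" using u P'(3) by (metis card_Diff1_less)
    ultimately have "move (U - {u}) (V - {v}) A \<in> \<A>" using small A by blast
    moreover have "move (U - {u}) (V - {v}) A \<inter> B = {}" using A dis v by (auto simp: move_def)
    ultimately show False using X B by blast
  qed
qed

text \<open>Two kept sets met before and two moved sets share \<open>U\<close>. Only the mixed cases
  need the stability under smaller pairs, through \<open>moved_meets\<close>.\<close>

lemma compress_cross:
  assumes P: "lex_pair W U V"
    and smallA: "\<And>U' V'. lex_pair W U' V' \<Longrightarrow> card U' < card U \<Longrightarrow> (\<forall>A\<in>\<A>. move U' V' A \<in> \<A>)"
    and smallB: "\<And>U' V'. lex_pair W U' V' \<Longrightarrow> card U' < card U \<Longrightarrow> (\<forall>A\<in>\<B>. move U' V' A \<in> \<B>)"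
    and X: "cross \<A> \<B>"
  shows "cross (compress U V \<A>) (compress U V \<B>)"
proof (intro ballI)
  fix A B assume AB: "A \<in> compress U V \<A>" "B \<in> compress U V \<B>"
  note P' = lex_pairD[OF P]
  have X': "cross \<B> \<A>" using X by blast
  have moved: "\<exists>C\<in>\<C>. A = move U V C \<and> V \<subseteq> C \<and> U \<inter> C = {} \<and> U \<subseteq> A"
    if "A \<in> compress U V \<C>" "A \<notin> \<C>" for A \<C>
    using that by (auto simp: mem_compress_iff move_def split: if_splits)
  have unmoved: "move U V A \<in> \<C>" if "A \<in> compress U V \<C>" "A \<in> \<C>" for A \<C>
    using that by (auto simp: mem_compress_iff)
  consider "A \<in> \<A>" "B \<in> \<B>" | "A \<notin> \<A>" "B \<in> \<B>" | "A \<in> \<A>" "B \<notin> \<B>" | "A \<notin> \<A>" "B \<notin> \<B>" by blast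
  then show "A \<inter> B \<noteq> {}"
  proof cases
    case 1 then show ?thesis using X by blast
  next
    case 2
    then obtain C where C: "C \<in> \<A>" "A = move U V C" "V \<subseteq> C" "U \<inter> C = {}" using moved AB by blast
    show ?thesis unfolding C(2)
      by (rule moved_meets[OF P _ X C(1,3,4) 2(2)]) (use smallA unmoved AB 2 in blast)+
  next
    case 3
    then obtain C where C: "C \<in> \<B>" "B = move U V C" "V \<subseteq> C" "U \<inter> C = {}" using moved AB by blast
    have "move U V C \<inter> A \<noteq> {}"
      by (rule moved_meets[OF P _ X' C(1,3,4) 3(1)]) (use smallB unmoved AB 3 in blast)+
    then show ?thesis unfolding C(2) by blast
  next
    case 4
    then have "U \<subseteq> A" "U \<subseteq> B" using moved AB by blast+
    then show ?thesis using P'(5) by blast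
  qed
qed

text \<open>A member missing \<open>y\<close> would leave \<open>n - l \<ge> k\<close> points, among
  them \<open>y\<close>, and so room for a disjoint \<open>k\<close>-set through
  \<open>y\<close>.\<close>

lemma star_cross_subset:
  assumes "cross (star n k y) \<B>" "\<B> \<subseteq> nsets {1..n} l" "1 \<le> k" "k + l \<le> n" "y \<in> {1..n}"
  shows "\<B> \<subseteq> star n l y"
proof
  fix B assume B: "B \<in> \<B>"
  then have B': "B \<subseteq> {1..n}" "card B = l" "finite B" using assms by (auto simp: nsets_def)
  have "y \<in> B"
  proof (rule ccontr)
    assume y: "y \<notin> B"
    have "k \<le> card ({1..n} - B)" using B' assms by (simp add: card_Diff_subset)
    then obtain A where "A \<in> nsets ({1..n} - B) k" "{y} \<subseteq> A"
      using nsets_between[of "{1..n} - B" "{y}" k] y assms by auto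
    then have "A \<in> star n k y" "A \<inter> B = {}" by (auto simp: nsets_def)
    then show False using assms B by blast
  qed
  then show "B \<in> star n l y" using B assms by blast
qed

text \<open>If a moved set \<open>A\<close> misses \<open>x\<close>, then some \<open>l\<close>-set through \<open>x\<close> avoids \<open>A\<close> and a further point
  of \<open>U\<close>. It was not moved, so it lies in \<open>\<B>\<close>.\<close>

lemma compress_star_subset:
  assumes P: "lex_pair {1..n} U V" and A: "\<A> \<subseteq> nsets {1..n} k" and X: "cross \<A> \<B>"
    and CA: "compress U V \<A> = star n k x" and CB: "compress U V \<B> = star n l x"
    and x: "x \<in> {1..n}" and n: "k + l < n" and kl: "1 \<le> k" "1 \<le> l" "card U \<le> l"
    and nU: "U \<noteq> {x}"
  shows "\<A> \<subseteq> star n k x"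
proof
  fix A assume "A \<in> \<A>"
  note P' = lex_pairD[OF P]
  have mA: "x \<in> move U V A"
    using move_in_compress[OF \<open>A \<in> \<A>\<close> P'(5,7)] CA by blast
  have A': "A \<subseteq> {1..n}" "card A = k" "finite A" using A \<open>A \<in> \<A>\<close> by (auto simp: nsets_def)
  have "x \<in> A"
  proof (rule ccontr)
    assume "x \<notin> A"
    then have xU: "x \<in> U" "V \<subseteq> A" "U \<inter> A = {}" using mA by (auto simp: move_def split: if_splits)
    then obtain u where u: "u \<in> U" "u \<noteq> x" using nU by blast
    let ?R = "{1..n} - insert u A"
    have "u \<notin> A" "u \<in> {1..n}" using u xU(3) P'(1) by blast+
    then have "card ?R = n - Suc k" using A' by (subst card_Diff_subset) auto
    then have "l \<le> card ?R" using n by simp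
    moreover have "{x} \<subseteq> ?R" using \<open>x \<notin> A\<close> u x by simp
    ultimately obtain B where B: "B \<in> nsets ?R l" "{x} \<subseteq> B"
      using nsets_between[of ?R "{x}" l] kl(2) by auto
    then have "B \<in> compress U V \<B>" unfolding CB by (auto simp: nsets_def)
    moreover have "u \<notin> B" "A \<inter> B = {}" using B by (auto simp: nsets_def)
    moreover have "u \<in> move U V C" if "B = move U V C" "B \<noteq> C" for C
      using that u(1) by (auto simp: move_def split: if_splits)
    ultimately have "B \<in> \<B>" by (metis mem_compress_iff)
    then show False using X \<open>A \<in> \<A>\<close> \<open>A \<inter> B = {}\<close> by blast
  qed
  then show "A \<in> star n k x" using A \<open>A \<in> \<A>\<close> by blast
qed

lemma star_eqI:
  assumes "\<A> \<subseteq> star n k y" "card \<A> = card (star n k x)" "x \<in> {1..n}" "y \<in> {1..n}" "1 \<le> k"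
  shows "\<A> = star n k y"
proof (rule card_subset_eq)
  show "finite (star n k y)" by (simp add: finite_imp_finite_nsets)
  show "card \<A> = card (star n k y)"
    unfolding assms(2) card_star[OF assms(3,5)] card_star[OF assms(4,5)] ..
qed (rule assms)

text \<open>For disjoint \<open>C\<close> and \<open>D\<close>, \<open>insert v C \<in> \<A>\<close> holds iff \<open>insert v D \<in> \<B>\<close>, and the
  disjointness graph is connected.\<close>

lemma compress_star_singleton:
  assumes A: "\<A> \<subseteq> nsets {1..n} k" and B: "\<B> \<subseteq> nsets {1..n} l" and X: "cross \<A> \<B>"
    and xv: "x \<in> {1..n}" "v \<in> {1..n}" "x \<noteq> v"
    and CA: "compress {x} {v} \<A> = star n k x" and CB: "compress {x} {v} \<B> = star n l x"
    and n: "k + l < n" and kl: "1 \<le> k" "1 \<le> l"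
  shows "\<A> \<subseteq> star n k x \<or> \<A> \<subseteq> star n k v"
proof (rule ccontr)
  assume neg: "\<not> ?thesis"
  let ?W = "{1..n} - {x, v}"
  \<comment> \<open>\<open>P\<close> records which sets \<open>C\<close> extend to members by
    \<open>v\<close>. The two members assumed to miss \<open>x\<close> and \<open>v\<close> show
    that \<open>P\<close> is neither empty nor everything.\<close>
  define P where "P = {C \<in> nsets ?W (k - 1). insert v C \<in> \<A>}"
  \<comment> \<open>The compressed family contains \<open>insert x C\<close> but not
    \<open>insert v C\<close>. Had both been present, \<open>insert v C\<close> would have been
    kept; had neither, nothing could have produced \<open>insert x C\<close>.\<close>
  have one: "insert v C \<in> \<C> \<longleftrightarrow> insert x C \<notin> \<C>"
    if "compress {x} {v} \<C> = star n m x" "C \<in> nsets ?W (m - 1)" "1 \<le> m" for C \<C> m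
  proof -
    have C: "C \<subseteq> ?W" "finite C" "card C = m - 1" using that by (auto simp: nsets_def)
    then have "x \<notin> C" "v \<notin> C" "C \<subseteq> {1..n}" by blast+
    then have "insert x C \<in> star n m x" using xv(1) C(2,3) that(3) by (simp add: nsets_def)
    then have "insert x C \<in> compress {x} {v} \<C>" using that by simp
    moreover have m1: "move {x} {v} (insert v C) = insert x C"
      using \<open>x \<notin> C\<close> \<open>v \<notin> C\<close> xv(3) by (simp add: move_def)
    moreover have "insert v C \<notin> compress {x} {v} \<C>" unfolding that(1)
      using \<open>x \<notin> C\<close> xv(3) by simp
    moreover have "B = insert v C" if "insert x C = move {x} {v} B" "B \<noteq> insert x C" for B
    proof -
      have "v \<in> B" "x \<notin> B" "insert x C = insert x (B - {v})"
        using that by (auto simp: move_def split: if_splits)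
      then have "C = B - {v}" using \<open>x \<notin> C\<close> by (metis Diff_iff insert_ident)
      then show ?thesis using \<open>v \<in> B\<close> by blast
    qed
    ultimately show ?thesis by (metis mem_compress_iff)
  qed
  have card_W: "card ?W = n - 2" using xv by (simp add: card_Diff_subset)
  obtain A1 where A1: "A1 \<in> \<A>" "x \<notin> A1" using neg A by blast
  obtain A2 where A2: "A2 \<in> \<A>" "v \<notin> A2" using neg A by blast
  have "x \<in> move {x} {v} A1" "x \<in> move {x} {v} A2"
    using move_in_compress[of A1 \<A> "{x}" "{v}"] move_in_compress[of A2 \<A> "{x}" "{v}"] A1 A2 xv CA
    by auto
  then have "v \<in> A1" "x \<in> A2" using A1 A2 by (auto simp: move_def split: if_splits)
  have A1': "A1 \<subseteq> {1..n}" "finite A1" "card A1 = k" using A A1 by (auto simp: nsets_def)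
  have A2': "A2 \<subseteq> {1..n}" "finite A2" "card A2 = k" using A A2 by (auto simp: nsets_def)
  have "A1 - {v} \<in> P" unfolding P_def
    using A1 A1' \<open>v \<in> A1\<close> by (auto simp: nsets_def insert_absorb)
  moreover have "A2 - {x} \<in> nsets ?W (k - 1)"
    using A2 A2' \<open>x \<in> A2\<close> by (auto simp: nsets_def)
  moreover have "insert x (A2 - {x}) \<in> \<A>" using A2 \<open>x \<in> A2\<close> by (simp add: insert_absorb)
  ultimately have "A2 - {x} \<in> nsets ?W (k - 1) - P" "A1 - {v} \<in> P"
    using one[OF CA _ kl(1)] by (auto simp: P_def)
  then obtain C1 C2 where C: "C1 \<in> P" "C2 \<in> nsets ?W (k - 1) - P" "card (C1 \<union> C2) \<le> k"
    using nsets_adjacent_pair[of ?W P "k - 1" "A1 - {v}" "A2 - {x}"] kl by (auto simp: P_def)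
  have "C1 \<union> C2 \<subseteq> ?W" "finite (C1 \<union> C2)" using C by (auto simp: P_def nsets_def)
  \<comment> \<open>At least \<open>n - 2 - k\<close> points of \<open>?W\<close> remain, and
    \<open>n - 2 - k \<ge> l - 1\<close> is exactly \<open>k + l < n\<close>.\<close>
  then have "l - 1 \<le> card (?W - (C1 \<union> C2))"
    using C(3) n kl card_W by (subst card_Diff_subset) auto
  then have "nsets (?W - (C1 \<union> C2)) (l - 1) \<noteq> {}" by (auto simp: nsets_eq_empty_iff)
  then obtain D where D: "D \<in> nsets (?W - (C1 \<union> C2)) (l - 1)" by blast
  have D': "D \<in> nsets ?W (l - 1)" using D by (auto simp: nsets_def)
  have "insert v C1 \<in> \<A>" "insert x C2 \<in> \<A>" using C one[OF CA _ kl(1)] by (auto simp: P_def)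
  moreover have "insert v C1 \<inter> insert x D = {}" "insert x C2 \<inter> insert v D = {}"
    using C D xv by (auto simp: P_def nsets_def)
  ultimately have "insert x D \<notin> \<B>" "insert v D \<notin> \<B>" using X by blast+
  then show False using one[OF CB D' kl(2)] by blast
qed

text \<open>If \<open>U\<close> has more than \<open>l\<close> points, \<open>\<B>\<close> was
  untouched and its star confines \<open>\<A>\<close>. If \<open>U\<close> has a point besides
  \<open>x\<close>, or misses \<open>x\<close>, the centre stays \<open>x\<close>. Only
  \<open>U = {x}\<close> can change the centre, and then the old one is \<open>x\<close> or the
  single point of \<open>V\<close>.\<close>

lemma stars_of_compress_stars:
  assumes P: "lex_pair {1..n} U V"
    and A: "\<A> \<subseteq> nsets {1..n} k" and B: "\<B> \<subseteq> nsets {1..n} l" and X: "cross \<A> \<B>"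
    and CA: "compress U V \<A> = star n k x" and CB: "compress U V \<B> = star n l x"
    and x: "x \<in> {1..n}" and n: "k + l < n" and kl: "1 \<le> k" "1 \<le> l"
  shows "\<exists>y\<in>{1..n}. \<A> = star n k y"
proof -
  note P' = lex_pairD[OF P]
  have X': "cross \<B> \<A>" using X by blast
  have cA: "card \<A> = card (star n k x)" and cB: "card \<B> = card (star n l x)"
    using card_compress[OF P'(7)] CA CB by metis+
  have id: "compress U V \<C> = \<C>" if "\<C> \<subseteq> nsets {1..n} m" "m < card U" for \<C> m
  proof -
    have "move U V A = A" if "A \<in> \<C>" for A
    proof -
      have "finite A" "card A = m" using that \<open>\<C> \<subseteq> nsets {1..n} m\<close> by (auto simp: nsets_def)
      then have "\<not> V \<subseteq> A" using card_mono[of A V] \<open>m < card U\<close> P'(8) by auto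
      then show ?thesis by (simp add: move_def)
    qed
    then show ?thesis by (auto simp: compress_def)
  qed
  consider "l < card U" | "card U \<le> l" "U \<noteq> {x}" | "U = {x}" by linarith
  then show ?thesis
  proof cases
    case 1
    then have "\<B> = star n l x" using id[OF B] CB by simp
    then have "\<A> \<subseteq> star n k x" using star_cross_subset[of n l x \<A> k] X' A kl n x by simp
    then show ?thesis using star_eqI cA x kl by blast
  next
    case 2
    then show ?thesis
      using compress_star_subset[OF P A X CA CB x n kl] star_eqI[OF _ cA x x kl(1)] x by blast
  next
    case 3
    then have "card V = 1" using P'(8) by simp
    then obtain v where v: "V = {v}" using card_1_singletonE by blast
    have v': "v \<in> {1..n}" "x \<noteq> v" using P'(2,7) v 3 by auto
    show ?thesis
      using compress_star_singleton[OF A B X x v' _ _ n kl] CA CB 3 v x v'(1)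
        star_eqI[OF _ cA x _ kl(1)] by blast
  qed
qed

text \<open>The deficit \<open>2 ^ n - 2 ^ (n - x)\<close> makes the weight decrease under every compression,
  since \<open>2 ^ (n - Min U)\<close> exceeds the sum of \<open>2 ^ (n - x)\<close> over all \<open>x > Min U\<close>.\<close>

definition weight :: "nat \<Rightarrow> nat set \<Rightarrow> nat" where
  "weight n A = (\<Sum>x\<in>A. 2 ^ n - 2 ^ (n - x))"

lemma weight_add: "finite A \<Longrightarrow> weight n A + (\<Sum>x\<in>A. 2 ^ (n - x)) = card A * 2 ^ n"
  unfolding weight_def sum.distrib[symmetric] by (simp add: power_increasing)

lemma weight_less:
  assumes "lex_pair {1..n} U V"
  shows "weight n U < weight n V"
proof -
  note P = lex_pairD[OF assms]
  let ?m = "Min U"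
  have V: "?m < x" "x \<le> n" if "x \<in> V" for x
    using that P(2,4,6,9) by auto
  have "inj_on (\<lambda>x. n - x) V" by (intro inj_onI) (metis V(2) diff_diff_cancel)
  then have "(\<Sum>x\<in>V. 2 ^ (n - x)) = (\<Sum>i\<in>(\<lambda>x. n - x) ` V. 2 ^ i :: nat)"
    by (simp add: sum.reindex)
  also have "\<dots> \<le> (\<Sum>i=0..<n - ?m. 2 ^ i)"
  proof (intro sum_mono2)
    show "(\<lambda>x. n - x) ` V \<subseteq> {0..<n - ?m}"
      using diff_less_mono2[OF V(1) less_le_trans[OF V(1) V(2)]] by auto
  qed auto
  also have "\<dots> < 2 ^ (n - ?m)" by (simp add: sum_power2)
  also have "\<dots> \<le> (\<Sum>x\<in>U. 2 ^ (n - x))"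
    using P(3,5) by (intro member_le_sum) auto
  finally show ?thesis
    using weight_add[OF P(3), of n] weight_add[OF P(4), of n] P(8) by simp
qed

lemma weight_move:
  assumes "lex_pair {1..n} U V" "finite A"
  shows "weight n (move U V A) \<le> weight n A"
    and "move U V A \<noteq> A \<Longrightarrow> weight n (move U V A) < weight n A"
proof -
  note P = lex_pairD[OF assms(1)]
  have *: "weight n (move U V A) < weight n A" if "V \<subseteq> A" "U \<inter> A = {}"
  proof -
    have "weight n ((A - V) \<union> U) = weight n (A - V) + weight n U"
      unfolding weight_def using that assms P by (intro sum.union_disjoint) auto
    also have "\<dots> < weight n (A - V) + weight n V" using weight_less[OF assms(1)] by simp
    also have "\<dots> = weight n A" unfolding weight_def using that assms by (metis sum.subset_diff)
    finally show ?thesis using that by (simp add: move_def)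
  qed
  show "weight n (move U V A) \<le> weight n A"
    using * by (cases "V \<subseteq> A \<and> U \<inter> A = {}") (auto simp: move_def)
  show "move U V A \<noteq> A \<Longrightarrow> weight n (move U V A) < weight n A"
    using * by (auto simp: move_def split: if_splits)
qed

lemma weight_compress:
  assumes P: "lex_pair {1..n} U V" and A: "\<A> \<subseteq> nsets {1..n} k"
  shows "sum (weight n) (compress U V \<A>) \<le> sum (weight n) \<A>"
    and "A \<in> \<A> \<Longrightarrow> move U V A \<notin> \<A> \<Longrightarrow> sum (weight n) (compress U V \<A>) < sum (weight n) \<A>"
proof -
  let ?f = "\<lambda>A. if move U V A \<in> \<A> then A else move U V A"
  have fin: "finite \<A>" using A finite_imp_finite_nsets finite_subset by blast
  have fA: "finite A" if "A \<in> \<A>" for A using that A by (auto simp: nsets_def)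
  have eq: "sum (weight n) (compress U V \<A>) = (\<Sum>A\<in>\<A>. weight n (?f A))"
    unfolding compress_def
    by (rule sum.reindex_cong[OF inj_on_compress[OF lex_pairD(7)[OF P]] refl refl])
  have le: "weight n (?f A) \<le> weight n A" if "A \<in> \<A>" for A
    using weight_move(1)[OF P fA[OF that]] by simp
  show "sum (weight n) (compress U V \<A>) \<le> sum (weight n) \<A>"
    unfolding eq by (rule sum_mono) (rule le)
  assume A0: "A \<in> \<A>" "move U V A \<notin> \<A>"
  then have "move U V A \<noteq> A" by auto
  then have "weight n (?f A) < weight n A" using weight_move(2)[OF P fA[OF A0(1)]] A0 by simp
  then show "sum (weight n) (compress U V \<A>) < sum (weight n) \<A>"
    unfolding eq using fin le A0(1) by (intro sum_strict_mono_ex1) blast+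
qed

section \<open>Simultaneous compression of all families\<close>

text \<open>Symmetric in the two indices, unlike \<open>cross_intersecting\<close>, so that facts
  about a pair apply in either order.\<close>

definition crossing :: "nat \<Rightarrow> nat set \<Rightarrow> (nat \<Rightarrow> nat) \<Rightarrow> (nat \<Rightarrow> nat set set) \<Rightarrow> bool" where
  "crossing n I k F \<longleftrightarrow> (\<forall>i\<in>I. F i \<subseteq> nsets {1..n} (k i)) \<and>
     (\<forall>i\<in>I. \<forall>j\<in>I. i \<noteq> j \<longrightarrow> cross (F i) (F j))"

definition stars :: "nat \<Rightarrow> nat set \<Rightarrow> (nat \<Rightarrow> nat) \<Rightarrow> (nat \<Rightarrow> nat set set) \<Rightarrow> bool" where
  "stars n I k F \<longleftrightarrow> (\<exists>x\<in>{1..n}. \<forall>i\<in>I. F i = star n (k i) x)"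

lemma crossing_compress:
  assumes F: "crossing n I k F" and P: "lex_pair {1..n} U V"
    and small: "\<And>i U' V'. i \<in> I \<Longrightarrow> lex_pair {1..n} U' V' \<Longrightarrow> card U' < card U \<Longrightarrow>
      (\<forall>A\<in>F i. move U' V' A \<in> F i)"
  shows "crossing n I k (\<lambda>i. compress U V (F i))"
  unfolding crossing_def
proof (rule conjI; (intro ballI impI)?)
  show "compress U V (F i) \<subseteq> nsets {1..n} (k i)" if "i \<in> I" for i
    using compress_in_nsets[OF P] F that by (simp add: crossing_def)
  fix i j A B assume ij: "i \<in> I" "j \<in> I" "i \<noteq> j"
    "A \<in> compress U V (F i)" "B \<in> compress U V (F j)"
  have "cross (compress U V (F i)) (compress U V (F j))"
    using F ij by (intro compress_cross[OF P]) (auto simp: crossing_def small)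
  then show "A \<inter> B \<noteq> {}" using ij by blast
qed

text \<open>The loose pair \<open>a\<close>, \<open>b\<close> only serves to show that
  \<open>F a\<close> was a star. That star confines every other family, where
  \<open>k a + k i \<le> n\<close> is enough, and the preserved cardinalities make the others full
  stars with the same centre.\<close>

lemma stars_compress:
  assumes F: "crossing n I k F" and P: "lex_pair {1..n} U V"
    and k: "\<And>i. i \<in> I \<Longrightarrow> 1 \<le> k i" "\<And>i j. i \<in> I \<Longrightarrow> j \<in> I \<Longrightarrow> i \<noteq> j \<Longrightarrow> k i + k j \<le> n"
    and ab: "a \<in> I" "b \<in> I" "a \<noteq> b" "k a + k b < n"
    and S: "stars n I k (\<lambda>i. compress U V (F i))"
  shows "stars n I k F"
proof -
  obtain x where x: "x \<in> {1..n}" "\<And>i. i \<in> I \<Longrightarrow> compress U V (F i) = star n (k i) x"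
    using S by (auto simp: stars_def)
  have Fi: "F i \<subseteq> nsets {1..n} (k i)" if "i \<in> I" for i using F that by (simp add: crossing_def)
  have X: "cross (F i) (F j)" if "i \<in> I" "j \<in> I" "i \<noteq> j" for i j
    using F that by (simp add: crossing_def)
  obtain y where y: "y \<in> {1..n}" "F a = star n (k a) y"
    using stars_of_compress_stars[OF P Fi Fi X x(2) x(2) x(1) ab(4) k(1) k(1)] ab by blast
  have "F i = star n (k i) y" if i: "i \<in> I" for i
  proof (cases "i = a")
    case False
    have "F i \<subseteq> star n (k i) y"
      using star_cross_subset[of n "k a" y "F i" "k i"] X[OF ab(1) i] y Fi[OF i] k ab(1) i False by auto
    moreover have "card (F i) = card (star n (k i) x)"
      using card_compress[OF lex_pairD(7)[OF P], of "F i"] x(2)[OF i] by simp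
    ultimately show ?thesis using star_eqI x(1) y(1) k(1)[OF i] by blast
  qed (use y in simp)
  then show ?thesis using y(1) by (auto simp: stars_def)
qed

theorem exists_compressed:
  assumes I: "finite I" and F: "crossing n I k F"
    and k: "\<And>i. i \<in> I \<Longrightarrow> 1 \<le> k i" "\<And>i j. i \<in> I \<Longrightarrow> j \<in> I \<Longrightarrow> i \<noteq> j \<Longrightarrow> k i + k j \<le> n"
    and ab: "a \<in> I" "b \<in> I" "a \<noteq> b" "k a + k b < n"
  obtains G where "crossing n I k G" "\<And>i. i \<in> I \<Longrightarrow> card (G i) = card (F i)"
    "\<And>i. i \<in> I \<Longrightarrow> compressed {1..n} (G i)" "stars n I k G \<Longrightarrow> stars n I k F"
proof -
  have "\<exists>G. crossing n I k G \<and> (\<forall>i\<in>I. card (G i) = card (F i)) \<and>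
    (\<forall>i\<in>I. compressed {1..n} (G i)) \<and> (stars n I k G \<longrightarrow> stars n I k F)"
    using F
  proof (induction "\<Sum>i\<in>I. sum (weight n) (F i)" arbitrary: F rule: less_induct)
    case less
    let ?bad = "\<lambda>p. lex_pair {1..n} (fst p) (snd p) \<and> (\<exists>i\<in>I. \<exists>A\<in>F i. move (fst p) (snd p) A \<notin> F i)"
    show ?case
    proof (cases "\<exists>p. ?bad p")
      case False
      then have "\<forall>i\<in>I. compressed {1..n} (F i)" by (auto simp: compressed_def)
      then show ?thesis using less.prems by blast
    next
      case True
      \<comment> \<open>The minimum is taken over the bad pairs of all families together, so a
        smaller pair moves nothing out of any family, as \<open>crossing_compress\<close>
        requires.\<close>
      then obtain p where p: "?bad p" "\<And>q. ?bad q \<Longrightarrow> card (fst p) \<le> card (fst q)"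
        using ex_has_least_nat[of ?bad _ "\<lambda>p. card (fst p)"] by blast
      obtain U V where UV: "p = (U, V)" by fastforce
      have P: "lex_pair {1..n} U V" using p(1) UV by simp
      obtain i A where iA: "i \<in> I" "A \<in> F i" "move U V A \<notin> F i" using p(1) UV by auto
      let ?G = "\<lambda>i. compress U V (F i)"
      have Fi: "F i \<subseteq> nsets {1..n} (k i)" if "i \<in> I" for i
        using less.prems that by (simp add: crossing_def)
      have G: "crossing n I k ?G"
        using p(2)[of "(_, _)"] UV by (intro crossing_compress[OF less.prems P]) fastforce
      have "(\<Sum>i\<in>I. sum (weight n) (?G i)) < (\<Sum>i\<in>I. sum (weight n) (F i))"
        using I weight_compress(1)[OF P Fi] weight_compress(2)[OF P Fi iA(2,3)] iA(1)
        by (intro sum_strict_mono_ex1) auto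
      then obtain H where H: "crossing n I k H" "\<forall>i\<in>I. card (H i) = card (?G i)"
        "\<forall>i\<in>I. compressed {1..n} (H i)" "stars n I k H \<longrightarrow> stars n I k ?G"
        using less.hyps[of ?G] G by blast
      moreover have "stars n I k ?G \<Longrightarrow> stars n I k F"
        using stars_compress[OF less.prems P k ab] .
      ultimately show ?thesis using card_compress[OF lex_pairD(7)[OF P]] by auto
    qed
  qed
  then show thesis using that by blast
qed

text \<open>A single move, with \<open>U = B - A\<close> and \<open>V = A - B\<close>, turns
  \<open>A\<close> into \<open>B\<close>: \<open>B - A\<close> contains \<open>d + 1\<close>, while
  \<open>A - B\<close> has only larger points.\<close>

lemma compressed_initial:
  assumes C: "compressed {1..n} \<A>" and A: "\<A> \<subseteq> nsets {1..n} k" "A \<in> \<A>" "{1..d} \<subseteq> A" "Suc d \<notin> A"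
    and B: "B \<in> nsets {1..n} k" "{1..Suc d} \<subseteq> B"
  shows "B \<in> \<A>"
proof -
  have A': "A \<subseteq> {1..n}" "finite A" "card A = k" using A by (auto simp: nsets_def)
  have B': "B \<subseteq> {1..n}" "finite B" "card B = k" using B by (auto simp: nsets_def)
  have AB: "card (A - B) = card (B - A)"
    using A' B' by (simp add: card_Diff_subset_Int Int_commute)
  have d: "Suc d \<in> B - A" using B A by auto
  then have "card (B - A) > 0" using B' by (auto simp: card_gt_0_iff)
  then have ne: "A - B \<noteq> {}" "B - A \<noteq> {}" using AB by force+
  have "Min (B - A) \<le> Suc d" using d B' by (intro Min_le) auto
  also have "Suc d < Min (A - B)"
  proof -
    have "x \<ge> 1" "x \<notin> {1..Suc d}" if "x \<in> A - B" for x using that A' B by auto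
    then have "Suc d < x" if "x \<in> A - B" for x using that by (metis atLeastAtMost_iff not_less)
    then show ?thesis using ne A' by simp
  qed
  finally have "lex_pair {1..n} (B - A) (A - B)"
    using A' B' AB ne by (auto simp: lex_pair_def)
  then have "move (B - A) (A - B) A \<in> \<A>" using C A by (auto simp: compressed_def)
  moreover have "move (B - A) (A - B) A = B" by (auto simp: move_def)
  ultimately show ?thesis by simp
qed

subsection \<open>Comparison of the totals of hitting configurations\<close>

text \<open>Unimodality and symmetry: the hypotheses say that \<open>b\<close> is no farther from
  \<open>m / 2\<close> than \<open>a\<close>.\<close>

lemma choose_le_choose:
  assumes "a \<le> b" "a + b \<le> m"
  shows "m choose a \<le> m choose b"
proof (cases "2 * b \<le> m")
  case False
  have "m choose b = m choose (m - b)" using assms by (intro binomial_symmetric) simp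
  then show ?thesis using False assms binomial_mono[of a "m - b" m] by simp
qed (use assms binomial_mono in blast)

lemma choose_diagonal_mono: "d \<le> e \<Longrightarrow> e \<le> k \<Longrightarrow> e \<le> n \<Longrightarrow> (n - e) choose (k - e) \<le> (n - d) choose (k - d)"
proof (induction e rule: dec_induct)
  case (step e)
  have "(n - e) choose (k - e) = ((n - Suc e) choose (k - Suc e)) + ((n - Suc e) choose (k - e))"
    using step.prems by (subst choose_reduce_nat) auto
  then show ?case using step by simp
qed simp

lemma Suc_mult_choose_Suc: "Suc k * (n choose Suc k) = (n - k) * (n choose k)"
  by (simp only: binomial_absorption binomial_absorb_comp)

text \<open>For \<open>s \<le> k\<close> this is the number of \<open>k\<close>-subsets of \<open>[n]\<close> that meet a fixed \<open>s\<close>-set without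
  containing it; for \<open>k < s\<close> the last term is \<open>1\<close>, not \<open>0\<close>.\<close>

definition partial_count :: "nat \<Rightarrow> nat \<Rightarrow> nat \<Rightarrow> int" where
  "partial_count n s k = int (n choose k) - int ((n - s) choose k) - int ((n - s) choose (k - s))"

text \<open>Absorption applied to the three binomials. For the first it produces the factor
  \<open>n - k\<close> exactly; for each of the other two it is off by \<open>s\<close>, and these
  discrepancies form the last term.\<close>

lemma partial_count_Suc:
  assumes "s \<le> k" "k + s \<le> n"
  shows "int (Suc k) * partial_count n s (Suc k) =
    int (n - k) * partial_count n s k + int s * (int ((n - s) choose k) - int ((n - s) choose (Suc k - s)))"
proof -
  define e m where "e = k - s" and "m = n - s"
  have k: "k = e + s" "n = m + s" "e + s \<le> m" using assms by (auto simp: e_def m_def)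
  have 1: "int (Suc k) * int (n choose Suc k) = int (n - k) * int (n choose k)"
    by (metis Suc_mult_choose_Suc of_nat_mult)
  have 2: "int (Suc k) * int (m choose Suc k) = int (m - k) * int (m choose k)"
    by (metis Suc_mult_choose_Suc of_nat_mult)
  have 3: "int (Suc e) * int (m choose Suc e) = int (m - e) * int (m choose e)"
    by (metis Suc_mult_choose_Suc of_nat_mult)
  have i: "int (n - k) = int m - int e" "int (m - k) = int m - int e - int s" "int (m - e) = int m - int e"
    "int (Suc k) = int e + int s + 1" "int (Suc e) = int e + 1"
    using k by simp_all
  have p: "partial_count n s (Suc k) = int (n choose Suc k) - int (m choose Suc k) - int (m choose Suc e)"
    "partial_count n s k = int (n choose k) - int (m choose k) - int (m choose e)"
    "Suc k - s = Suc e" "n - s = m"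
    using k by (auto simp: partial_count_def)
  show ?thesis using 1 2 3 unfolding p i by (simp add: algebra_simps)
qed

text \<open>Complementation preserves meeting an \<open>s\<close>-set without containing it; the two
  subtracted binomials change places.\<close>

lemma partial_count_symmetric:
  assumes "s \<le> k" "k + s \<le> n"
  shows "partial_count n s (n - k) = partial_count n s k"
proof -
  have "n choose (n - k) = n choose k" using assms binomial_symmetric[of k n] by simp
  moreover have "(n - s) choose (n - k) = (n - s) choose (k - s)"
    using assms binomial_symmetric[of "k - s" "n - s"] by simp
  moreover have "(n - s) choose (n - k - s) = (n - s) choose k"
    using assms binomial_symmetric[of k "n - s"] by (simp add: add.commute)
  ultimately show ?thesis by (simp add: partial_count_def)
qed

lemma partial_count_pos:
  assumes "2 \<le> s" "s \<le> k" "k + s \<le> n"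
  shows "0 < partial_count n s k"
proof -
  have "n choose k = ((n - 1) choose (k - 1)) + ((n - 1) choose k)"
    using assms by (intro choose_reduce_nat) auto
  moreover have "(n - 1) choose k = ((n - 2) choose (k - 1)) + ((n - 2) choose k)"
    using assms by (subst choose_reduce_nat) (auto simp: numeral_2_eq_2)
  moreover have "(n - s) choose k \<le> (n - 2) choose k"
    using assms by (intro binomial_right_mono) simp
  moreover have "(n - s) choose (k - s) \<le> (n - 1) choose (k - 1)"
    using assms by (intro choose_diagonal_mono) auto
  moreover have "0 < (n - 2) choose (k - 1)" using assms unfolding zero_less_binomial_iff by linarith
  ultimately have "int (n choose k) > int ((n - s) choose k) + int ((n - s) choose (k - s))" by linarith
  then show ?thesis by (simp add: partial_count_def)
qed

lemma partial_count_le_Suc: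
  assumes "1 \<le> s" "s \<le> k" "2 * k + 1 \<le> n"
  shows "int (n - k) * partial_count n s k \<le> int (Suc k) * partial_count n s (Suc k)"
proof -
  have "(n - s) choose (Suc k - s) \<le> (n - s) choose k"
    using assms by (intro choose_le_choose) auto
  then show ?thesis using partial_count_Suc[of s k n] assms by simp
qed

lemma partial_count_mono:
  assumes "2 \<le> s" "s \<le> a" "a \<le> b" "2 * b \<le> n"
  shows "partial_count n s a \<le> partial_count n s b"
  using assms(3,4)
proof (induction b rule: dec_induct)
  case (step b)
  have "int (Suc b) * partial_count n s b \<le> int (n - b) * partial_count n s b"
    using step assms partial_count_pos[of s b n] by (intro mult_right_mono) auto
  also have "\<dots> \<le> int (Suc b) * partial_count n s (Suc b)"
    using step assms by (intro partial_count_le_Suc) auto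
  finally have "partial_count n s b \<le> partial_count n s (Suc b)"
    by (simp only: mult_le_cancel_left_pos of_nat_0_less_iff zero_less_Suc)
  then show ?case using step by simp
qed simp

text \<open>\<open>c\<close> is \<open>b\<close> or its mirror image \<open>n - b\<close>, whichever
  lies in the lower half, where \<open>partial_count\<close> grows; \<open>a + b < n\<close> puts
  \<open>a\<close> strictly below it. The lemma is what makes the largest uniformity the best place
  for the hitting family.\<close>

lemma partial_count_less:
  assumes "2 \<le> s" "s \<le> a" "a < b" "a + b < n"
  shows "partial_count n s a < partial_count n s b"
proof -
  define c where "c = min b (n - b)"
  have c: "a < c" "2 * c \<le> n" using assms by (auto simp: c_def)
  have "int (Suc a) * partial_count n s a < int (n - a) * partial_count n s a"
    using c assms partial_count_pos[of s a n] by (intro mult_strict_right_mono) auto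
  also have "\<dots> \<le> int (Suc a) * partial_count n s (Suc a)"
    using c assms by (intro partial_count_le_Suc) auto
  finally have "partial_count n s a < partial_count n s (Suc a)"
    by (simp only: mult_less_cancel_left_pos of_nat_0_less_iff zero_less_Suc)
  also have "\<dots> \<le> partial_count n s c"
    using c assms by (intro partial_count_mono) auto
  also have "\<dots> = partial_count n s b"
    using assms partial_count_symmetric[of s b n] by (auto simp: c_def min_def)
  finally show ?thesis .
qed

section \<open>The totals as a function of the length of the initial segment\<close>

locale uniformities =
  fixes n r :: nat and k :: "nat \<Rightarrow> nat"
  assumes r: "2 \<le> r"
    and k_pos: "i \<in> {1..r} \<Longrightarrow> 1 \<le> k i"
    and k_anti: "i \<in> {1..r} \<Longrightarrow> j \<in> {1..r} \<Longrightarrow> i \<le> j \<Longrightarrow> k j \<le> k i"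
    and n_ge: "k 1 + k 2 \<le> n"
    and loose_pair: "\<exists>a\<in>{1..r}. \<exists>b\<in>{1..r}. a \<noteq> b \<and> k a + k b < n"
begin

lemma pair_le:
  assumes "i \<in> {1..r}" "j \<in> {1..r}" "i \<noteq> j"
  shows "k i + k j \<le> n"
proof -
  have *: "k i + k j \<le> n" if "i \<in> {1..r}" "j \<in> {1..r}" "i < j" for i j
    using that k_anti[of 1 i] k_anti[of 2 j] n_ge r by auto
  show ?thesis using *[of i j] *[of j i] assms by (cases "i < j") auto
qed

lemma k_less: "i \<in> {1..r} \<Longrightarrow> k i < n"
  using pair_le[of i 1] pair_le[of 1 2] k_pos[of 1] k_pos[of 2] r by (cases "i = 1") auto

text \<open>The greatest \<open>d\<close> for which every family other than the \<open>j\<close>-th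
  has room for sets containing \<open>[d]\<close>. For \<open>j\<close> in \<open>{1..r}\<close> it
  is \<open>k r\<close>, except when \<open>j = r\<close> and
  \<open>k (r - 1) > k r\<close>.\<close>

definition other_min :: "nat \<Rightarrow> nat" where
  "other_min j = Min (k ` ({1..r} - {j}))"

lemma others_nonempty: "{1..r} - {j} \<noteq> {}"
proof -
  have "1 \<in> {1..r} - {j} \<or> 2 \<in> {1..r} - {j}" using r by auto
  then show ?thesis by blast
qed

lemma other_min_le: "i \<in> {1..r} \<Longrightarrow> i \<noteq> j \<Longrightarrow> other_min j \<le> k i"
  unfolding other_min_def by (intro Min_le) auto

lemma other_min_attained: obtains i where "i \<in> {1..r}" "i \<noteq> j" "k i = other_min j"
proof -
  have "other_min j \<in> k ` ({1..r} - {j})"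
    unfolding other_min_def
    using others_nonempty[of j] by (intro Min_in finite_imageI finite_Diff) simp_all
  then obtain i where "i \<in> {1..r} - {j}" "other_min j = k i" by (rule imageE)
  then show thesis using that[of i] by simp
qed

lemma other_min_eqI: "i \<in> {1..r} \<Longrightarrow> i \<noteq> j \<Longrightarrow> (\<And>i'. i' \<in> {1..r} \<Longrightarrow> i' \<noteq> j \<Longrightarrow> k i \<le> k i') \<Longrightarrow>
    other_min j = k i"
  unfolding other_min_def by (rule Min_eqI) blast+

text \<open>The total size when the \<open>j\<close>-th family consists of the sets that meet \<open>[d]\<close> and the
  others consist of the sets that contain \<open>[d]\<close>.\<close>

definition hit_total :: "nat \<Rightarrow> nat \<Rightarrow> int" where
  "hit_total j d = int (n choose k j) - int ((n - d) choose k j) +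
     (\<Sum>i\<in>{1..r} - {j}. int ((n - d) choose (k i - d)))"

text \<open>The step from \<open>d\<close> to \<open>d + 1\<close> after Pascal's rule: the
  \<open>j\<close>-th family gains the sets that contain \<open>d + 1\<close> and avoid
  \<open>[d]\<close>, each other one loses the sets that contain \<open>[d]\<close> but not
  \<open>d + 1\<close>.\<close>

definition hit_diff :: "nat \<Rightarrow> nat \<Rightarrow> int" where
  "hit_diff j d = int ((n - d - 1) choose (k j - 1)) -
     (\<Sum>i\<in>{1..r} - {j}. int ((n - d - 1) choose (k i - d)))"

text \<open>The sum now runs over all indices and is independent of \<open>j\<close>, so
  transferring the hitting family to another index changes \<open>partial_count\<close>
  only.\<close>

lemma hit_total_alt: "j \<in> {1..r} \<Longrightarrow>
    hit_total j d = partial_count n d (k j) + (\<Sum>i\<in>{1..r}. int ((n - d) choose (k i - d)))"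
  unfolding hit_total_def partial_count_def by (subst sum.remove[of "{1..r}" j]) auto

lemma hit_total_Suc:
  assumes j: "j \<in> {1..r}" and d: "d < other_min j"
  shows "hit_total j (Suc d) = hit_total j d + hit_diff j d"
proof -
  have dk: "d < k i" if "i \<in> {1..r} - {j}" for i using other_min_le[of i j] that d by auto
  have "d < n" using dk others_nonempty[of j] k_less by fastforce
  then have "(n - d) choose k j = ((n - d - 1) choose (k j - 1)) + ((n - d - 1) choose k j)"
    using k_pos[OF j] by (intro choose_reduce_nat) auto
  moreover have "(n - d) choose (k i - d) =
      ((n - d - 1) choose (k i - Suc d)) + ((n - d - 1) choose (k i - d))" if "i \<in> {1..r} - {j}" for i
    using \<open>d < n\<close> dk[OF that] by (subst choose_reduce_nat) auto
  ultimately show ?thesis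
    by (simp add: hit_total_def hit_diff_def sum.distrib)
qed

text \<open>Absorption returns each binomial to the upper index \<open>n - d - 1\<close>. The
  factors \<open>k i - d\<close> differ from the common factor \<open>n - d - k j\<close> by
  \<open>n - k j - k i \<ge> 0\<close>, so a nonnegative \<open>hit_diff\<close> stays
  nonnegative.\<close>

lemma hit_diff_Suc:
  assumes j: "j \<in> {1..r}" and d: "Suc d < other_min j"
  shows "int (n - d - 1) * hit_diff j (Suc d) = int (n - d - k j) * hit_diff j d +
    (\<Sum>i\<in>{1..r} - {j}. int (n - k j - k i) * int ((n - d - 1) choose (k i - d)))"
proof -
  let ?N = "n - d - 1"
  have dk: "Suc d < k i" "k j + k i \<le> n" if "i \<in> {1..r} - {j}" for i
    using other_min_le[of i j] pair_le[of j i] that d j by auto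
  obtain i0 where "i0 \<in> {1..r} - {j}" using others_nonempty by blast
  then have kn: "d + k j < n" using dk[of i0] by linarith
  have "int ?N * int ((?N - 1) choose (k j - 1)) = int (?N - (k j - 1)) * int (?N choose (k j - 1))"
    by (metis binomial_absorb_comp of_nat_mult)
  moreover have "?N - (k j - 1) = n - d - k j" using k_pos[OF j] by simp
  moreover have "int ?N * int ((?N - 1) choose (k i - Suc d)) = int (k i - d) * int (?N choose (k i - d))"
    if "i \<in> {1..r} - {j}" for i
    using dk[OF that] times_binomial_minus1_eq[of "k i - d" ?N] by (metis Suc_lessD diff_Suc_eq_diff_pred diff_commute of_nat_mult zero_less_diff)
  ultimately have "int ?N * hit_diff j (Suc d) = int (n - d - k j) * int (?N choose (k j - 1)) -
      (\<Sum>i\<in>{1..r} - {j}. int (k i - d) * int (?N choose (k i - d)))"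
    by (simp add: hit_diff_def right_diff_distrib sum_distrib_left)
  also have "(\<Sum>i\<in>{1..r} - {j}. int (k i - d) * int (?N choose (k i - d))) =
      (\<Sum>i\<in>{1..r} - {j}. int (n - d - k j) * int (?N choose (k i - d)) -
        int (n - k j - k i) * int (?N choose (k i - d)))"
  proof (intro sum.cong refl)
    fix i assume i: "i \<in> {1..r} - {j}"
    have "int (k i - d) = int (n - d - k j) - int (n - k j - k i)" using dk[OF i] kn by simp
    then show "int (k i - d) * int (?N choose (k i - d)) = int (n - d - k j) * int (?N choose (k i - d)) -
        int (n - k j - k i) * int (?N choose (k i - d))" by (simp add: left_diff_distrib)
  qed
  finally show ?thesis by (simp add: hit_diff_def right_diff_distrib sum_subtractf sum_distrib_left)
qed

text \<open>If \<open>k j + k i = n\<close> for all other \<open>i\<close>, all binomials in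
  \<open>hit_diff j d\<close> agree by symmetry. The loose pair then avoids \<open>j\<close>, so at
  least two of them are subtracted from one, and the difference is negative.\<close>

lemma loose_partner:
  assumes j: "j \<in> {1..r}" and d: "d < other_min j" "0 \<le> hit_diff j d"
  shows "\<exists>i\<in>{1..r} - {j}. k j + k i < n"
proof (rule ccontr)
  assume neg: "\<not> ?thesis"
  have eq: "k j + k i = n" if "i \<in> {1..r} - {j}" for i
    using neg pair_le[of j i] that j by force
  obtain a b where ab: "a \<in> {1..r}" "b \<in> {1..r}" "a \<noteq> b" "k a + k b < n"
    using loose_pair by blast
  have "a \<noteq> j" "b \<noteq> j" using ab eq[of a] eq[of b] by auto
  then have "card {a, b} \<le> card ({1..r} - {j})" using ab by (intro card_mono) auto
  then have c: "2 \<le> card ({1..r} - {j})" using ab by simp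
  let ?C = "(n - d - 1) choose (k j - 1)"
  have "(n - d - 1) choose (k i - d) = ?C" if i: "i \<in> {1..r} - {j}" for i
  proof -
    have dk: "d < k i" using other_min_le[of i j] i d by auto
    have "k j - 1 = n - d - 1 - (k i - d)" using eq[OF i] dk k_pos[OF j] by simp
    then show ?thesis using binomial_symmetric[of "k i - d" "n - d - 1"] eq[OF i] dk k_pos[OF j] by simp
  qed
  then have "hit_diff j d = int ?C * (1 - int (card ({1..r} - {j})))"
    by (simp add: hit_diff_def right_diff_distrib)
  moreover have "0 < ?C"
  proof -
    obtain i where i: "i \<in> {1..r} - {j}" using others_nonempty by blast
    show ?thesis using eq[OF i] other_min_le[of i j] i d by auto
  qed
  ultimately show False using d(2) c by (simp add: zero_le_mult_iff)
qed

lemma hit_diff_pos_Suc: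
  assumes j: "j \<in> {1..r}" and d: "Suc d < other_min j" "0 \<le> hit_diff j d"
  shows "0 < hit_diff j (Suc d)"
proof -
  obtain i where i: "i \<in> {1..r} - {j}" "k j + k i < n" using loose_partner[of j d] j d by (meson Suc_lessD)
  have "d < k i" using other_min_le[of i j] d i by auto
  then have "0 < (n - d - 1) choose (k i - d)" using i k_pos[OF j] by simp
  then have "0 < (\<Sum>i\<in>{1..r} - {j}. int (n - k j - k i) * int ((n - d - 1) choose (k i - d)))"
    using i by (intro sum_pos2[of _ i]) auto
  moreover have "0 \<le> int (n - d - k j) * hit_diff j d" using d by simp
  ultimately have "0 < int (n - d - 1) * hit_diff j (Suc d)" using hit_diff_Suc[OF j d(1)] by linarith
  then show ?thesis by (simp add: zero_less_mult_iff)
qed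


lemma hit_diff_pos_mono:
  assumes j: "j \<in> {1..r}" and "d < e" "e < other_min j" "0 \<le> hit_diff j d"
  shows "0 < hit_diff j e"
proof -
  have "0 \<le> hit_diff j e \<and> (d < e \<longrightarrow> 0 < hit_diff j e)" if "d \<le> e" "e < other_min j" for e
    using that
  proof (induction e rule: dec_induct)
    case (step e)
    then show ?case using hit_diff_pos_Suc[OF j, of e] by simp
  qed (use assms in simp)
  from this[of e] show ?thesis using assms by simp
qed

text \<open>The sign of the step into \<open>d\<close> decides: if it is nonnegative, all later
  steps are positive and the right end is larger; if it is negative, so are all earlier steps and
  the value at 1 is larger.\<close>

lemma hit_total_interior:
  assumes j: "j \<in> {1..r}" and d: "1 < d" "d < other_min j"
  shows "hit_total j d < max (hit_total j 1) (hit_total j (other_min j))"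
proof (cases "0 \<le> hit_diff j (d - 1)")
  case True
  have "hit_total j d < hit_total j e" if "Suc d \<le> e" "e \<le> other_min j" for e
    using that
  proof (induction e rule: dec_induct)
    case base
    then show ?case
      using hit_total_Suc[OF j, of d] hit_diff_pos_mono[OF j _ _ True, of d] d by simp
  next
    case (step e)
    have "d - 1 < e" using step.hyps d by linarith
    then show ?case
      using step hit_total_Suc[OF j, of e] hit_diff_pos_mono[OF j _ _ True, of e] d by simp
  qed
  from this[of "other_min j"] show ?thesis using d by simp
next
  case False
  have neg: "hit_diff j e < 0" if "e < d" for e
  proof (rule ccontr)
    assume "\<not> hit_diff j e < 0"
    moreover have "e = d - 1 \<or> e < d - 1" using that by linarith
    ultimately have "0 \<le> hit_diff j (d - 1)"
      using hit_diff_pos_mono[OF j, of e "d - 1"] d by force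
    then show False using False by simp
  qed
  have "hit_total j e < hit_total j 1" if "2 \<le> e" "e \<le> d" for e
    using that
  proof (induction e rule: dec_induct)
    case base
    then show ?case using hit_total_Suc[OF j, of 1] neg[of 1] d by (simp add: numeral_2_eq_2)
  next
    case (step e)
    then show ?case using hit_total_Suc[OF j, of e] neg[of e] d by simp
  qed
  from this[of d] show ?thesis using d by simp
qed

lemma hit_total_le_max:
  assumes "j \<in> {1..r}" "1 \<le> d" "d \<le> other_min j"
  shows "hit_total j d \<le> max (hit_total j 1) (hit_total j (other_min j))"
  using hit_total_interior[of j d] assms by (cases "d = 1 \<or> d = other_min j") auto

section \<open>Comparison of the end values with the two bounds\<close>

text \<open>Meeting and containing a single point are the same, so
  \<open>partial_count n 1 (k j)\<close> vanishes by Pascal's rule.\<close>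

lemma hit_total_1:
  assumes j: "j \<in> {1..r}"
  shows "hit_total j 1 = int (star_bound n r k)"
proof -
  have "n choose k j = ((n - 1) choose (k j - 1)) + ((n - 1) choose k j)"
    using k_pos[OF j] k_less[OF j] by (intro choose_reduce_nat) auto
  then have "partial_count n 1 (k j) = 0" by (simp add: partial_count_def)
  then show ?thesis by (simp add: hit_total_alt[OF j] star_bound_def)
qed

lemma r_in: "1 \<in> {1..r}" "2 \<in> {1..r}" "r \<in> {1..r}" using r by auto

lemma hit_total_first: "hit_total 1 (k r) = int (hitting_bound n r k)"
proof -
  have "{1..r} - {1} = {2..r}" by auto
  moreover have "(n - k r) choose k 1 \<le> n choose k 1" by (intro binomial_right_mono) simp
  ultimately show ?thesis by (simp add: hit_total_def hitting_bound_def of_nat_diff)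
qed

lemma hit_total_cong: "i \<in> {1..r} \<Longrightarrow> j \<in> {1..r} \<Longrightarrow> k i = k j \<Longrightarrow> hit_total i d = hit_total j d"
  by (simp add: hit_total_alt)

lemma other_min_eq_last:
  assumes j: "j \<in> {1..r}" "j \<noteq> r \<or> k (r - 1) = k r"
  shows "other_min j = k r"
proof (cases "j = r")
  case True
  have "other_min j = k (r - 1)"
    using True r k_anti by (intro other_min_eqI) auto
  then show ?thesis using True j by simp
qed (use k_anti r_in in \<open>auto intro: other_min_eqI\<close>)

text \<open>As \<open>k 1 + k 2 = n\<close>, the binomial subtracted for index 1 equals the one
  added for index 2. What remains, \<open>n choose k 1\<close>, is the contribution of the first two
  stars. Each later term is at most that of a star, and at index \<open>r\<close> it is 1, strictly
  less.\<close>

lemma hitting_less_star: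
  assumes "2 \<le> k r" "3 \<le> r" "k 1 + k 2 = n"
  shows "hitting_bound n r k < star_bound n r k"
proof -
  let ?s = "k r"
  have I: "{1..r} = insert 1 (insert 2 {3..r})" using r by auto
  have sk: "?s \<le> k i" if "i \<in> {1..r}" for i using k_anti[of i r] that by auto
  have le: "(n - ?s) choose (k i - ?s) \<le> (n - 1) choose (k i - 1)" if "i \<in> {1..r}" for i
    using assms sk[OF that] k_less[OF r_in(3)] by (intro choose_diagonal_mono) auto
  have "1 < (n - 1) choose (?s - 1)"
  proof -
    have "?s - 1 < n - 1" "0 < ?s - 1" using assms k_less[OF r_in(3)] by auto
    then have "(n - 1) choose 1 \<le> (n - 1) choose (?s - 1)"
      using assms sk[of 1] sk[of 2] r by (intro choose_le_choose) auto
    then show ?thesis using assms k_pos[of 1] k_pos[of 2] sk[of 1] r by simp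
  qed
  then have "(\<Sum>i\<in>{3..r}. (n - ?s) choose (k i - ?s)) < (\<Sum>i\<in>{3..r}. (n - 1) choose (k i - 1))"
    using assms(2) le by (intro sum_strict_mono_ex1 bexI[of _ r]) auto
  moreover have "(n - ?s) choose (k 2 - ?s) = (n - ?s) choose k 1"
    using binomial_symmetric[of "k 1" "n - ?s"] assms(3) sk[OF r_in(2)] by auto
  moreover have "(n - ?s) choose k 1 \<le> n choose k 1" by (intro binomial_right_mono) simp
  moreover have "{2..r} = insert 2 {3..r}" using r by auto
  ultimately have "hitting_bound n r k < (n choose k 1) + (\<Sum>i\<in>{3..r}. (n - 1) choose (k i - 1))"
    by (simp add: hitting_bound_def)
  also have "n choose k 1 = ((n - 1) choose (k 1 - 1)) + ((n - 1) choose k 1)"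
    using k_pos[OF r_in(1)] k_less[OF r_in(1)] by (intro choose_reduce_nat) auto
  also have "(n - 1) choose k 1 = (n - 1) choose (k 2 - 1)"
    using binomial_symmetric[of "k 1" "n - 1"] assms(3) k_pos[OF r_in(2)] k_less[OF r_in(1)]
    by (metis Nat.add_diff_assoc add_diff_cancel_left' diff_commute le_add1 assms(3) diff_diff_left less_imp_le_nat Suc_leI Suc_diff_le)
  finally show ?thesis using I by (simp add: star_bound_def)
qed

text \<open>If \<open>k 1 + k j < n\<close>, transferring the hitting family to index 1 increases
  the total strictly. If \<open>k 1 + k j = n\<close>, it changes nothing by symmetry, and only the
  star bound gives strictness.\<close>

lemma hit_total_smaller:
  assumes j: "j \<in> {1..r}" "k j < k 1" and s: "2 \<le> k r"
  shows "hit_total j (k r) < int (max (hitting_bound n r k) (star_bound n r k))"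
proof -
  have sj: "k r \<le> k j" using k_anti[of j r] j by auto
  have "j \<noteq> 1" using j by auto
  then have le: "k 1 + k j \<le> n" using pair_le[of 1 j] j r_in by auto
  show ?thesis
  proof (cases "k 1 + k j = n")
    case False
    then have "partial_count n (k r) (k j) < partial_count n (k r) (k 1)"
      using s sj j le by (intro partial_count_less) auto
    then have "hit_total j (k r) < hit_total 1 (k r)"
      using j r_in by (simp add: hit_total_alt)
    then show ?thesis using hit_total_first by simp
  next
    case True
    have "k j \<le> k 2" using k_anti[of 2 j] j \<open>j \<noteq> 1\<close> by auto
    then have k2: "k 1 + k 2 = n" using True n_ge by simp
    have "r \<noteq> 2"
    proof
      assume "r = 2"
      then have "{1..r} = {1, 2}" by auto
      then show False using loose_pair k2 by auto
    qed
    then have "hitting_bound n r k < star_bound n r k"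
      using hitting_less_star s r k2 by simp
    moreover have "k j = n - k 1" using True by simp
    then have "partial_count n (k r) (k j) = partial_count n (k r) (k 1)"
      using partial_count_symmetric[of "k r" "k 1" n] True sj j by simp
    then have "hit_total j (k r) = hit_total 1 (k r)"
      using j r_in by (simp add: hit_total_alt)
    ultimately show ?thesis using hit_total_first by simp
  qed
qed

text \<open>This disposes of the exceptional value of \<open>other_min\<close>, for
  \<open>j = r\<close>. The hitting family moves to index \<open>r - 1\<close> and \<open>S\<close>
  shrinks to size \<open>k r\<close>. The proportion of sets missing \<open>S\<close> is the same in
  both situations, by \<open>rho\<close>, so the larger level contains more sets that meet
  \<open>S\<close>; the remaining families grow as \<open>S\<close> shrinks.\<close>

lemma hit_total_last_less:
  assumes "k r < k (r - 1)"
  shows "hit_total r (k (r - 1)) < hit_total (r - 1) (k r)"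
proof -
  let ?t = "r - 1" and ?p = "k r" and ?q = "k (r - 1)"
  have t: "?t \<in> {1..r}" "?t \<noteq> r" using r by auto
  have pq: "?q + ?p \<le> n" using pair_le[OF t(1) r_in(3) t(2)] by simp
  have "?q + ?p < n"
  proof (cases "?q = k 1")
    case True
    show ?thesis
    proof (rule ccontr)
      assume "\<not> ?thesis"
      then have "k 1 + k r = n" using pq True by simp
      then have "k 2 \<le> k r" using n_ge by simp
      then have "r - 1 = 1"
        using assms k_anti[of 2 "r - 1"] r by (cases "2 \<le> r - 1") auto
      then have "r = 2" using r by simp
      then have "{1..r} = {1, 2}" by auto
      then show False using loose_pair \<open>k 1 + k r = n\<close> \<open>r = 2\<close> by auto
    qed
  next
    case False
    then show ?thesis using k_anti[of 1 ?t] t pair_le[of 1 r] r by auto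
  qed
  have rho: "(n choose ?p) * ((n - ?p) choose ?q) = (n choose ?q) * ((n - ?q) choose ?p)"
    by (rule choose_mult_disjoint)
  have less: "int (n choose ?p) - int ((n - ?q) choose ?p) < int (n choose ?q) - int ((n - ?p) choose ?q)"
  proof -
    let ?a = "int (n choose ?p)" and ?b = "int (n choose ?q)"
      and ?c = "int ((n - ?q) choose ?p)" and ?d = "int ((n - ?p) choose ?q)"
    have lt: "?a < ?b"
    proof (cases "2 * ?q \<le> n")
      case True then show ?thesis using binomial_strict_mono[OF assms True] by simp
    next
      case False
      have "n choose ?q = n choose (n - ?q)" using pq by (intro binomial_symmetric) simp
      then show ?thesis using binomial_strict_mono[of ?p "n - ?q" n] False \<open>?q + ?p < n\<close> by simp
    qed
    have eq: "?a * ?d = ?b * ?c" using rho by (metis of_nat_mult)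
    have "?c < ?a"
    proof -
      have "n choose ?p = ((n - 1) choose (?p - 1)) + ((n - 1) choose ?p)"
        using k_pos[OF r_in(3)] k_less[OF r_in(3)] by (intro choose_reduce_nat) auto
      moreover have "(n - ?q) choose ?p \<le> (n - 1) choose ?p"
        using assms by (intro binomial_right_mono) simp
      moreover have "0 < (n - 1) choose (?p - 1)"
        using k_less[OF r_in(3)] unfolding zero_less_binomial_iff by linarith
      ultimately show ?thesis by linarith
    qed
    have "?a > 0" using pq by simp
    have "?a * (?b - ?d) = ?b * (?a - ?c)" using eq by (simp add: algebra_simps)
    also have "\<dots> > ?a * (?a - ?c)" using lt \<open>?c < ?a\<close> by simp
    finally show ?thesis using \<open>?a > 0\<close> by simp
  qed
  have It: "{1..r} - {?t} = insert r ({1..r} - {?t, r})" "{1..r} - {r} = insert ?t ({1..r} - {?t, r})"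
    using t r by auto
  have "(\<Sum>i\<in>{1..r} - {?t, r}. int ((n - ?q) choose (k i - ?q))) \<le>
      (\<Sum>i\<in>{1..r} - {?t, r}. int ((n - ?p) choose (k i - ?p)))"
  proof (intro sum_mono)
    fix i assume "i \<in> {1..r} - {?t, r}"
    then have "?q \<le> k i" using k_anti[of i ?t] t by auto
    then show "int ((n - ?q) choose (k i - ?q)) \<le> int ((n - ?p) choose (k i - ?p))"
      using assms pq by (simp add: choose_diagonal_mono)
  qed
  moreover have "hit_total r ?q = int (n choose ?p) - int ((n - ?q) choose ?p) +
      (1 + (\<Sum>i\<in>{1..r} - {?t, r}. int ((n - ?q) choose (k i - ?q))))"
    unfolding hit_total_def It(2) by (subst sum.insert) auto
  moreover have "hit_total ?t ?p = int (n choose ?q) - int ((n - ?p) choose ?q) +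
      (1 + (\<Sum>i\<in>{1..r} - {?t, r}. int ((n - ?p) choose (k i - ?p))))"
    unfolding hit_total_def It(1) by (subst sum.insert) auto
  ultimately show ?thesis using less by linarith
qed

lemma hit_total_other_min:
  assumes j: "j \<in> {1..r}" and s: "2 \<le> other_min j"
  shows "hit_total j (other_min j) \<le> int (max (hitting_bound n r k) (star_bound n r k))"
    and "hit_total j (other_min j) = int (max (hitting_bound n r k) (star_bound n r k)) \<Longrightarrow>
      k j = k 1 \<and> other_min j = k r"
proof -
  let ?M = "int (max (hitting_bound n r k) (star_bound n r k))"
  have main: "hit_total j (other_min j) < ?M \<or>
    hit_total j (other_min j) \<le> ?M \<and> k j = k 1 \<and> other_min j = k r"
  proof (cases "j \<noteq> r \<or> k (r - 1) = k r")
    case True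
    then have o: "other_min j = k r" using other_min_eq_last j by blast
    show ?thesis
    proof (cases "k j = k 1")
      case True
      then have "hit_total j (k r) = int (hitting_bound n r k)"
        using hit_total_cong[OF j r_in(1)] hit_total_first by simp
      then show ?thesis using True o by simp
    next
      case False
      then have "k j < k 1" using k_anti[of 1 j] j by auto
      then show ?thesis using hit_total_smaller[OF j] o s by simp
    qed
  next
    case False
    let ?t = "r - 1"
    have t: "?t \<in> {1..r}" "?t \<noteq> r" using r by auto
    have lt: "k r < k ?t" using False k_anti[of ?t r] t by auto
    have "other_min j = k ?t"
      using False t k_anti by (intro other_min_eqI) auto
    then have "hit_total j (other_min j) < hit_total ?t (k r)"
      using hit_total_last_less[OF lt] False by simp
    also have "\<dots> \<le> ?M"
    proof (cases "k ?t = k 1")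
      case True
      then show ?thesis using hit_total_cong[OF t(1) r_in(1)] hit_total_first by simp
    next
      case False
      then have "k ?t < k 1" using k_anti[OF r_in(1) t(1)] t(1) by simp
      \<comment> \<open>\<open>hit_total_smaller\<close> needs \<open>2 \<le> k r\<close>. For
        \<open>k r = 1\<close> the value is the star bound; strictness has been obtained
        already.\<close>
      moreover have "hit_total ?t (k r) = int (star_bound n r k)" if "k r = 1"
        using hit_total_1[OF t(1)] that by simp
      moreover have "k r = 1 \<or> 2 \<le> k r" using k_pos[OF r_in(3)] by auto
      ultimately show ?thesis using hit_total_smaller[OF t(1)] by force
    qed
    finally show ?thesis by simp
  qed
  then show "hit_total j (other_min j) \<le> ?M" by linarith
  show "k j = k 1 \<and> other_min j = k r" if "hit_total j (other_min j) = ?M" using main that by linarith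
qed

end

subsection \<open>Compressed families\<close>

context uniformities begin

definition size_bound :: nat where
  "size_bound = max (hitting_bound n r k) (star_bound n r k)"

lemma card_le_meeting:
  assumes "\<A> \<subseteq> nsets {1..n} m" "\<And>A. A \<in> \<A> \<Longrightarrow> A \<inter> {1..d} \<noteq> {}" "d \<le> n"
  shows "int (card \<A>) \<le> int (n choose m) - int ((n - d) choose m)"
proof -
  have "\<A> \<subseteq> {A \<in> nsets {1..n} m. A \<inter> {1..d} \<noteq> {}}" using assms by blast
  then have "card \<A> \<le> card {A \<in> nsets {1..n} m. A \<inter> {1..d} \<noteq> {}}"
    by (intro card_mono) (simp_all add: finite_imp_finite_nsets)
  then show ?thesis using card_nsets_meeting[of "{1..n}" "{1..d}" m] assms(3) by auto
qed

lemma card_le_superset: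
  assumes "\<A> \<subseteq> nsets {1..n} m" "\<And>A. A \<in> \<A> \<Longrightarrow> {1..d} \<subseteq> A" "d \<le> n" "d \<le> m"
  shows "card \<A> \<le> (n - d) choose (m - d)"
proof -
  have "\<A> \<subseteq> {A \<in> nsets {1..n} m. {1..d} \<subseteq> A}" using assms by blast
  then have "card \<A> \<le> card {A \<in> nsets {1..n} m. {1..d} \<subseteq> A}"
    by (intro card_mono) (simp_all add: finite_imp_finite_nsets)
  then show ?thesis using card_nsets_superset[of "{1..n}" "{1..d}" m] assms(3,4) by simp
qed

lemma total_hit:
  assumes G: "crossing n {1..r} k G" and j: "j \<in> {1..r}"
    and ne: "\<And>i. i \<in> {1..r} \<Longrightarrow> G i \<noteq> {}"
    and c: "\<And>i A. i \<in> {1..r} - {j} \<Longrightarrow> A \<in> G i \<Longrightarrow> {1..other_min j} \<subseteq> A"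
    and A: "A \<in> G j" "1 \<notin> A"
  shows "2 \<le> other_min j"
    and "int (\<Sum>i=1..r. card (G i)) \<le> hit_total j (other_min j)"
    and "int (\<Sum>i=1..r. card (G i)) = hit_total j (other_min j) \<Longrightarrow>
      card (G j) + ((n - other_min j) choose k j) = n choose k j \<and>
      (\<forall>i\<in>{1..r} - {j}. card (G i) = (n - other_min j) choose (k i - other_min j))"
proof -
  let ?s = "other_min j"
  have Gi: "G i \<subseteq> nsets {1..n} (k i)" if "i \<in> {1..r}" for i using G that by (simp add: crossing_def)
  obtain i0 where i0: "i0 \<in> {1..r}" "i0 \<noteq> j" "k i0 = ?s" using other_min_attained by blast
  obtain S where S: "S \<in> G i0" using ne i0 by blast
  then have S': "finite S" "card S = ?s" using Gi[OF i0(1)] i0 by (auto simp: nsets_def)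
  \<comment> \<open>A family of the least other uniformity consists of the single set
    \<open>[s]\<close>, so cross-intersection makes every member of \<open>G j\<close> meet
    \<open>[s]\<close>.\<close>
  then have "S = {1..?s}" using c[of i0 S] S i0 card_subset_eq[of S "{1..?s}"] by simp
  then have meet: "B \<inter> {1..?s} \<noteq> {}" if "B \<in> G j" for B
    using G S i0 j that unfolding crossing_def by metis
  have sn: "?s \<le> n" using i0 k_less[OF i0(1)] by simp
  obtain x where "x \<in> A" "x \<in> {1..?s}" using meet[OF A(1)] by blast
  then have "1 \<le> x" "x \<le> ?s" "x \<noteq> 1" using A(2) by auto
  then show "2 \<le> ?s" by linarith
  define u where "u i = (if i = j then int (n choose k j) - int ((n - ?s) choose k j)
    else int ((n - ?s) choose (k i - ?s)))" for i
  have le: "int (card (G i)) \<le> u i" if i: "i \<in> {1..r}" for i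
  proof (cases "i = j")
    case True
    then show ?thesis using card_le_meeting[OF Gi[OF j] meet sn] by (simp add: u_def)
  next
    case False
    then have "card (G i) \<le> (n - ?s) choose (k i - ?s)"
      using i other_min_le[of i j] by (intro card_le_superset[OF Gi[OF i] c sn]) auto
    then show ?thesis using False by (simp add: u_def)
  qed
  have u: "sum u {1..r} = hit_total j ?s"
    using j unfolding hit_total_def by (subst sum.remove[of "{1..r}" j]) (auto simp: u_def)
  show "int (\<Sum>i=1..r. card (G i)) \<le> hit_total j ?s"
    unfolding u[symmetric] of_nat_sum by (rule sum_mono) (rule le)
  assume "int (\<Sum>i=1..r. card (G i)) = hit_total j ?s"
  then have "(\<Sum>i\<in>{1..r}. int (card (G i))) = sum u {1..r}" using u by simp
  then have eq: "int (card (G i)) = u i" if "i \<in> {1..r}" for i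
    using sum_mono_inv[of "\<lambda>i. int (card (G i))" "{1..r}" u i] le that by simp
  have "card (G j) + ((n - ?s) choose k j) = n choose k j"
    using eq[OF j] by (simp add: u_def)
  moreover have "card (G i) = (n - ?s) choose (k i - ?s)" if "i \<in> {1..r} - {j}" for i
    using eq[of i] that by (simp add: u_def)
  ultimately show "card (G j) + ((n - ?s) choose k j) = n choose k j \<and>
      (\<forall>i\<in>{1..r} - {j}. card (G i) = (n - ?s) choose (k i - ?s))" by blast
qed

text \<open>Here the total is at most a convex combination of \<open>hit_total j d\<close> and
  \<open>hit_total j (Suc d)\<close>.\<close>

lemma total_interpolated:
  assumes G: "crossing n {1..r} k G" and j: "j \<in> {1..r}"
    and comp: "\<And>i. i \<in> {1..r} \<Longrightarrow> compressed {1..n} (G i)"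
    and d: "1 \<le> d" "d < other_min j"
    and c: "\<And>i A. i \<in> {1..r} - {j} \<Longrightarrow> A \<in> G i \<Longrightarrow> {1..d} \<subseteq> A"
    and i0: "i0 \<in> {1..r} - {j}" "A0 \<in> G i0" "Suc d \<notin> A0"
    and A1: "A1 \<in> G j" "1 \<notin> A1"
  shows "int (\<Sum>i=1..r. card (G i)) < max (hit_total j 1) (hit_total j (other_min j))"
proof -
  let ?J = "{1..r} - {j}" and ?W = "{Suc (Suc d)..n}" and ?N = "n - d - 1"
  have Gi: "G i \<subseteq> nsets {1..n} (k i)" if "i \<in> {1..r}" for i using G that by (simp add: crossing_def)
  have dk: "d < k i" "k j + k i \<le> n" "k i < n" if "i \<in> ?J" for i
    using other_min_le[of i j] pair_le[of j i] that d j k_less[of i] by auto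
  have dn: "Suc d \<le> n" using dk[OF i0(1)] by simp
  have W: "finite ?W" "card ?W = ?N" by auto
  have kj: "1 \<le> k j" using k_pos j by blast
  \<comment> \<open>A member of \<open>G j\<close> avoiding \<open>[d + 1]\<close> would leave room
    for a disjoint \<open>k i0\<close>-set through \<open>[d + 1]\<close>, but \<open>A0\<close>
    forces all such sets into \<open>G i0\<close>.\<close>
  have meet: "A \<inter> {1..Suc d} \<noteq> {}" if A: "A \<in> G j" for A
  proof
    assume dis: "A \<inter> {1..Suc d} = {}"
    have A': "A \<subseteq> {1..n}" "finite A" "card A = k j" using A Gi[OF j] by (auto simp: nsets_def)
    have "card ({1..n} - A) = n - k j" using A' by (simp add: card_Diff_subset)
    then have "k i0 \<le> card ({1..n} - A)" using dk[OF i0(1)] by simp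
    moreover have "{1..Suc d} \<subseteq> {1..n} - A" "card {1..Suc d} \<le> k i0"
      using dis dn dk[OF i0(1)] by auto
    ultimately obtain B where B: "B \<in> nsets ({1..n} - A) (k i0)" "{1..Suc d} \<subseteq> B"
      using nsets_between[of "{1..n} - A" "{1..Suc d}" "k i0"] by blast
    then have "B \<in> nsets {1..n} (k i0)" by (auto simp: nsets_def)
    then have "B \<in> G i0"
      using compressed_initial[OF comp Gi i0(2) c i0(3)] B i0 by blast
    moreover have "A \<inter> B = {}" using B by (auto simp: nsets_def)
    ultimately show False using G A i0 j unfolding crossing_def by blast
  qed
  \<comment> \<open>The competing sets: members of \<open>G j\<close> that miss \<open>[d]\<close>,
    hence contain \<open>d + 1\<close>, and members of the others that miss \<open>d + 1\<close>.
    Stripping \<open>d + 1\<close> from the former and \<open>[d]\<close> from the latter removes no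
    common point, so the traces on \<open>?W\<close> still cross-intersect.\<close>
  define \<A> where "\<A> = {A \<in> G j. A \<inter> {1..d} = {}}"
  define \<B> where "\<B> i = {A \<in> G i. Suc d \<notin> A}" for i
  define \<A>' where "\<A>' = (\<lambda>A. A - {Suc d}) ` \<A>"
  define \<B>' where "\<B>' i = (\<lambda>A. A - {1..d}) ` \<B> i" for i
  have SA: "Suc d \<in> A" if "A \<in> \<A>" for A
    using meet[of A] that by (auto simp: \<A>_def atLeastAtMostSuc_conv)
  have cA: "card \<A>' = card \<A>" unfolding \<A>'_def
    by (intro card_image inj_onI) (metis SA insert_Diff)
  have cB: "card (\<B>' i) = card (\<B> i)" if "i \<in> ?J" for i unfolding \<B>'_def
  proof (intro card_image inj_onI)
    fix A B assume "A \<in> \<B> i" "B \<in> \<B> i" "A - {1..d} = B - {1..d}"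
    moreover from this have "{1..d} \<subseteq> A" "{1..d} \<subseteq> B" using c[OF that] by (auto simp: \<B>_def)
    ultimately show "A = B" by blast
  qed
  have out: "x \<in> ?W" if "x \<in> {1..n}" "x \<notin> {1..d}" "x \<noteq> Suc d" for x using that by auto
  have subA: "\<A>' \<subseteq> nsets ?W (k j - 1)"
  proof
    fix X assume "X \<in> \<A>'"
    then obtain A where A: "A \<in> \<A>" "X = A - {Suc d}" by (auto simp: \<A>'_def)
    then have A': "A \<subseteq> {1..n}" "finite A" "card A = k j" "A \<inter> {1..d} = {}"
      using Gi[OF j] by (auto simp: \<A>_def nsets_def)
    have "A - {Suc d} \<subseteq> ?W"
    proof
      fix x assume "x \<in> A - {Suc d}"
      then show "x \<in> ?W" using A'(1,4) by (intro out) blast+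
    qed
    then show "X \<in> nsets ?W (k j - 1)"
      unfolding A(2) nsets_def using SA[OF A(1)] A' by simp
  qed
  have subB: "\<B>' i \<subseteq> nsets ?W (k i - d)" if i: "i \<in> ?J" for i
  proof
    fix X assume "X \<in> \<B>' i"
    then obtain A where A: "A \<in> G i" "Suc d \<notin> A" "X = A - {1..d}" by (auto simp: \<B>'_def \<B>_def)
    then have A': "A \<subseteq> {1..n}" "finite A" "card A = k i" "{1..d} \<subseteq> A"
      using Gi[of i] i c[OF i] by (auto simp: nsets_def)
    have "A - {1..d} \<subseteq> ?W"
    proof
      fix x assume "x \<in> A - {1..d}"
      then show "x \<in> ?W" using A'(1) A(2) by (intro out) blast+
    qed
    then show "X \<in> nsets ?W (k i - d)"
      unfolding A(3) nsets_def using A' by (simp add: card_Diff_subset)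
  qed
  have X: "cross \<A>' (\<B>' i)" if i: "i \<in> ?J" for i
  proof (intro ballI)
    fix X Y assume "X \<in> \<A>'" "Y \<in> \<B>' i"
    then obtain A B where AB: "A \<in> \<A>" "X = A - {Suc d}" "B \<in> \<B> i" "Y = B - {1..d}"
      by (auto simp: \<A>'_def \<B>'_def)
    have "A \<inter> B \<noteq> {}"
      using AB i j G by (auto simp: \<A>_def \<B>_def crossing_def)
    then show "X \<inter> Y \<noteq> {}" using AB by (auto simp: \<A>_def \<B>_def)
  qed
  define a where "a = int (card \<A>)"
  define b where "b i = int (card (\<B> i))" for i
  define \<alpha> where "\<alpha> = int (?N choose (k j - 1))"
  define \<beta> where "\<beta> i = int (?N choose (k i - d))" for i
  \<comment> \<open>The part shared by two neighbouring totals: adding all \<open>\<beta> i\<close>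
    gives \<open>hit_total j d\<close>, adding \<open>\<alpha>\<close> gives
    \<open>hit_total j (Suc d)\<close>.\<close>
  define base where "base = int (n choose k j) - int ((n - d) choose k j) +
    (\<Sum>i\<in>?J. int (?N choose (k i - Suc d)))"
  have kN: "(k j - 1) + (k i - d) \<le> ?N" if "i \<in> ?J" for i using dk[OF that] kj by simp
  have \<alpha>: "0 < \<alpha>" using kN[OF i0(1)] by (simp add: \<alpha>_def)
  have \<beta>: "0 < \<beta> i" if "i \<in> ?J" for i using kN[OF that] by (simp add: \<beta>_def)
  have fA: "finite \<A>'" using subA W finite_imp_finite_nsets finite_subset by blast
  have a\<alpha>: "a \<le> \<alpha>"
    using card_mono[OF finite_imp_finite_nsets[OF W(1)] subA] W by (simp add: a_def \<alpha>_def cA)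
  then have diff: "int ((?N choose (k j - 1)) - card \<A>') = \<alpha> - a"
    by (simp add: a_def \<alpha>_def cA of_nat_diff)
  have b: "b i * \<alpha> \<le> (\<alpha> - a) * \<beta> i" if i: "i \<in> ?J" for i
    using cross_pair_bound(1)[OF W subA subB X kN, OF i i i] cB[OF i] diff
    unfolding b_def \<alpha>_def[symmetric] \<beta>_def by (metis \<alpha>_def of_nat_le_iff of_nat_mult)
  have b_strict: "b i * \<alpha> < (\<alpha> - a) * \<beta> i" if i: "i \<in> ?J" "k j + k i < n" "0 < a" "a < \<alpha>" for i
  proof (cases "\<B>' i = {}")
    case True
    then have "b i = 0" using cB[OF i(1)] by (simp add: b_def)
    then show ?thesis using \<beta>[OF i(1)] i(4) by simp
  next
    case False
    have "\<A>' \<noteq> {}" using i(3) cA by (auto simp: a_def)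
    moreover have "(k j - 1) + (k i - d) < ?N" using dk[OF i(1)] kj i(2) by simp
    ultimately show ?thesis
      using cross_pair_bound(2)[OF W subA subB X kN, OF i(1) i(1) i(1)] False cB[OF i(1)] diff
      unfolding b_def \<alpha>_def[symmetric] \<beta>_def by (metis \<alpha>_def of_nat_less_iff of_nat_mult)
  qed
  have "0 < b i0"
  proof -
    have "A0 \<in> \<B> i0" using i0 by (simp add: \<B>_def)
    moreover have "finite (\<B> i0)" using finite_subset[OF Gi, of i0] i0
      by (auto simp: \<B>_def finite_imp_finite_nsets)
    ultimately show ?thesis by (auto simp: b_def card_gt_0_iff)
  qed
  then have "0 < (\<alpha> - a) * \<beta> i0" using b[OF i0(1)] \<alpha> by (smt (verit) mult_pos_pos)
  then have a_less: "a < \<alpha>" using \<beta>[OF i0(1)] by (simp add: zero_less_mult_iff)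
  have Gj: "int (card (G j)) \<le> int (n choose k j) - int ((n - d) choose k j) + a"
  proof -
    have "G j = {A \<in> G j. A \<inter> {1..d} \<noteq> {}} \<union> \<A>" by (auto simp: \<A>_def)
    then have "card (G j) \<le> card {A \<in> G j. A \<inter> {1..d} \<noteq> {}} + card \<A>" by (metis card_Un_le)
    moreover have "int (card {A \<in> G j. A \<inter> {1..d} \<noteq> {}}) \<le> int (n choose k j) - int ((n - d) choose k j)"
      using Gi[OF j] dn by (intro card_le_meeting) auto
    ultimately show ?thesis by (simp add: a_def)
  qed
  have Gother: "int (card (G i)) \<le> int (?N choose (k i - Suc d)) + b i" if i: "i \<in> ?J" for i
  proof -
    have "G i = {A \<in> G i. Suc d \<in> A} \<union> \<B> i" by (auto simp: \<B>_def)
    then have "card (G i) \<le> card {A \<in> G i. Suc d \<in> A} + card (\<B> i)" by (metis card_Un_le)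
    moreover have "card {A \<in> G i. Suc d \<in> A} \<le> (n - Suc d) choose (k i - Suc d)"
      using Gi[of i] dn i dk[OF i] c[OF i] by (intro card_le_superset) (auto simp: atLeastAtMostSuc_conv)
    ultimately show ?thesis by (simp add: b_def)
  qed
  have tot: "int (\<Sum>i=1..r. card (G i)) \<le> base + a + sum b ?J"
  proof -
    have "int (\<Sum>i=1..r. card (G i)) = int (card (G j)) + (\<Sum>i\<in>?J. int (card (G i)))"
      unfolding of_nat_sum using j by (intro sum.remove) auto
    also have "\<dots> \<le> int (card (G j)) + (\<Sum>i\<in>?J. int (?N choose (k i - Suc d)) + b i)"
      by (intro add_left_mono sum_mono Gother)
    finally show ?thesis using Gj by (simp add: base_def sum.distrib)
  qed
  have h1: "hit_total j d = base + sum \<beta> ?J"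
  proof -
    have "int ((n - d) choose (k i - d)) = int (?N choose (k i - Suc d)) + \<beta> i" if "i \<in> ?J" for i
      using dk[OF that] dn choose_reduce_nat[of "n - d" "k i - d"] by (simp add: \<beta>_def)
    then show ?thesis by (simp add: hit_total_def base_def sum.distrib)
  qed
  have h2: "hit_total j (Suc d) = base + \<alpha>"
    using hit_total_Suc[OF j d(2)] h1 by (simp add: hit_diff_def \<alpha>_def \<beta>_def)
  define M where "M = max (hit_total j 1) (hit_total j (other_min j))"
  have hM: "hit_total j d \<le> M" "hit_total j (Suc d) \<le> M"
    using hit_total_le_max[OF j, of d] hit_total_le_max[OF j, of "Suc d"] d by (auto simp: M_def)
  have a0: "0 \<le> a" by (simp add: a_def)
  have sb: "sum b ?J * \<alpha> \<le> (\<alpha> - a) * sum \<beta> ?J"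
    unfolding sum_distrib_right sum_distrib_left by (intro sum_mono b)
  \<comment> \<open>The weights are \<open>a / \<alpha>\<close> and
    \<open>(\<alpha> - a) / \<alpha>\<close>, multiplied out; the last bracket is at most 0 by
    \<open>sb\<close>.\<close>
  have comb: "(base + a + sum b ?J) * \<alpha> =
      a * hit_total j (Suc d) + (\<alpha> - a) * hit_total j d + (sum b ?J * \<alpha> - (\<alpha> - a) * sum \<beta> ?J)"
    unfolding h1 h2 by (simp add: algebra_simps)
  have MM: "a * hit_total j (Suc d) \<le> a * M" "(\<alpha> - a) * hit_total j d \<le> (\<alpha> - a) * M"
    using hM a0 a_less by (auto intro: mult_left_mono)
  have Meq: "a * M + (\<alpha> - a) * M = M * \<alpha>" by (simp add: algebra_simps)
  have "(base + a + sum b ?J) * \<alpha> < M * \<alpha>"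
  proof (cases "hit_total j d < M")
    case True
    then have "(\<alpha> - a) * hit_total j d < (\<alpha> - a) * M" using a_less by simp
    then show ?thesis using comb sb MM Meq by linarith
  next
    case False
    \<comment> \<open>A maximal value at \<open>d < other_min j\<close> is possible only at
      \<open>d = 1\<close>. There \<open>A1\<close>, which misses 1, makes the weight
      \<open>a\<close> of the other value positive.\<close>
    then have d1: "d = 1" using hit_total_interior[OF j, of d] d unfolding M_def by linarith
    have "A1 \<in> \<A>" using A1 d1 by (simp add: \<A>_def)
    moreover have "finite \<A>" using finite_subset[OF Gi[OF j]]
      by (auto simp: \<A>_def finite_imp_finite_nsets)
    ultimately have a_pos: "0 < a" by (auto simp: a_def card_gt_0_iff)
    show ?thesis
    proof (cases "hit_total j (Suc d) < M")
      case True
      then have "a * hit_total j (Suc d) < a * M" using a_pos by simp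
      then show ?thesis using comb sb MM Meq by linarith
    next
      case False
      \<comment> \<open>Both values are maximal, so the convex combination yields no strictness; it
        comes from a loose partner of \<open>j\<close>, whose disjointness estimate is strict for
        \<open>0 < a < \<alpha>\<close>.\<close>
      then have "hit_diff j d = 0"
        using \<open>\<not> hit_total j d < M\<close> hM hit_total_Suc[OF j d(2)] by simp
      then obtain i where i: "i \<in> ?J" "k j + k i < n" using loose_partner[OF j d(2)] by force
      have "sum b ?J * \<alpha> < (\<alpha> - a) * sum \<beta> ?J"
        unfolding sum_distrib_right sum_distrib_left
        using b b_strict[OF i a_pos a_less] i(1) by (intro sum_strict_mono_ex1) auto
      then show ?thesis using comb MM Meq by linarith
    qed
  qed
  then have "base + a + sum b ?J < M" using \<alpha> by simp
  then show ?thesis using tot by (simp add: M_def)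
qed

theorem compressed_total:
  assumes G: "crossing n {1..r} k G"
    and comp: "\<And>i. i \<in> {1..r} \<Longrightarrow> compressed {1..n} (G i)"
    and ne: "\<And>i. i \<in> {1..r} \<Longrightarrow> G i \<noteq> {}"
  shows "(\<Sum>i=1..r. card (G i)) \<le> size_bound"
    and "(\<Sum>i=1..r. card (G i)) = size_bound \<Longrightarrow> stars n {1..r} k G \<or>
      (\<exists>j\<in>{1..r}. k j = k 1 \<and> card (G j) + ((n - k r) choose k j) = n choose k j \<and>
        (\<forall>i\<in>{1..r} - {j}. card (G i) = (n - k r) choose (k i - k r)))"
proof -
  let ?hit = "\<exists>j\<in>{1..r}. k j = k 1 \<and> card (G j) + ((n - k r) choose k j) = n choose k j \<and>
        (\<forall>i\<in>{1..r} - {j}. card (G i) = (n - k r) choose (k i - k r))"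
  have Gi: "G i \<subseteq> nsets {1..n} (k i)" if "i \<in> {1..r}" for i using G that by (simp add: crossing_def)
  have n1: "1 \<in> {1..n}" using k_less[OF r_in(1)] by auto
  have "(\<Sum>i=1..r. card (G i)) \<le> size_bound \<and>
    ((\<Sum>i=1..r. card (G i)) = size_bound \<longrightarrow> stars n {1..r} k G \<or> ?hit)"
  proof (cases "\<forall>i\<in>{1..r}. G i \<subseteq> star n (k i) 1")
    case True
    have le: "card (G i) \<le> (n - 1) choose (k i - 1)" if i: "i \<in> {1..r}" for i
      using card_mono[of "star n (k i) 1" "G i"] True i card_star[OF n1 k_pos[OF i]]
      by (simp add: finite_imp_finite_nsets)
    have "(\<Sum>i=1..r. card (G i)) \<le> star_bound n r k" unfolding star_bound_def by (rule sum_mono) (rule le)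
    moreover have "stars n {1..r} k G" if eq: "(\<Sum>i=1..r. card (G i)) = star_bound n r k"
    proof -
      have "G i = star n (k i) 1" if i: "i \<in> {1..r}" for i
      proof (rule card_subset_eq)
        show "card (G i) = card (star n (k i) 1)"
          unfolding card_star[OF n1 k_pos[OF i]]
          using sum_mono_inv[OF eq[unfolded star_bound_def] le i] by simp
      qed (use True i in \<open>auto simp: finite_imp_finite_nsets\<close>)
      then show ?thesis using n1 by (auto simp: stars_def)
    qed
    ultimately show ?thesis unfolding size_bound_def by linarith
  next
    case False
    then obtain j A1 where j: "j \<in> {1..r}" and A1: "A1 \<in> G j" "1 \<notin> A1" using Gi by fastforce
    let ?J = "{1..r} - {j}" and ?s = "other_min j"
    \<comment> \<open>The instance \<open>d = 0\<close>: \<open>A1\<close> misses 1, so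
      \<open>G j\<close> contains the full star of 1, and this star confines all other families to
      stars of 1.\<close>
    have "star n (k j) 1 \<subseteq> G j"
      using compressed_initial[OF comp[OF j] Gi[OF j] A1(1), of 0] A1(2) by auto
    then have one: "G i \<subseteq> star n (k i) 1" if i: "i \<in> ?J" for i
      using star_cross_subset[of n "k j" 1 "G i" "k i"] G i j Gi[of i] k_pos[OF j] pair_le[of j i] n1
      unfolding crossing_def by blast
    define D where "D = {d. d \<le> ?s \<and> (\<forall>i\<in>?J. \<forall>A\<in>G i. {1..d} \<subseteq> A)}"
    have s1: "1 \<le> ?s" using other_min_attained k_pos by metis
    have "{1..1} \<subseteq> A" if "i \<in> ?J" "A \<in> G i" for i A using one[OF that(1)] that(2) by auto
    then have D1: "1 \<in> D" using s1 by (simp add: D_def)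
    have finD: "finite D" by (rule finite_subset[of _ "{..?s}"]) (auto simp: D_def)
    define d where "d = Max D"
    have dD: "d \<in> D" unfolding d_def using finD D1 by (intro Max_in) auto
    have d1: "1 \<le> d" unfolding d_def using finD D1 by simp
    have c: "{1..d} \<subseteq> A" if "i \<in> ?J" "A \<in> G i" for i A using dD that by (auto simp: D_def)
    have le: "hit_total j 1 \<le> int size_bound" using hit_total_1[OF j] by (simp add: size_bound_def)
    show ?thesis
    proof (cases "d = ?s")
      case True
      have c': "{1..?s} \<subseteq> A" if "i \<in> ?J" "A \<in> G i" for i A using c[OF that] True by simp
      have hit: "2 \<le> ?s" "int (\<Sum>i=1..r. card (G i)) \<le> hit_total j ?s"
        "int (\<Sum>i=1..r. card (G i)) = hit_total j ?s \<Longrightarrow>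
          card (G j) + ((n - ?s) choose k j) = n choose k j \<and>
          (\<forall>i\<in>?J. card (G i) = (n - ?s) choose (k i - ?s))"
        by (rule total_hit[OF G j _ _ A1]; (rule ne | rule c' | assumption); assumption)+
      note bd = hit_total_other_min[OF j hit(1), folded size_bound_def]
      have "?hit" if "(\<Sum>i=1..r. card (G i)) = size_bound"
      proof -
        have "hit_total j ?s = int size_bound" "int (\<Sum>i=1..r. card (G i)) = hit_total j ?s"
          using hit(2) bd(1) that by linarith+
        note eq = hit(3)[OF this(2)] bd(2)[OF this(1)]
        show ?thesis by (rule bexI[OF _ j]) (use eq in simp)
      qed
      then show ?thesis using hit(2) bd(1) by linarith
    next
      case False
      then have ds: "d < ?s" using dD by (simp add: D_def)
      have "Suc d \<notin> D" using Max_ge[OF finD] by (metis Suc_n_not_le_n d_def)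
      then have "\<exists>i\<in>?J. \<exists>A\<in>G i. \<not> {1..Suc d} \<subseteq> A"
        using ds unfolding D_def by simp
      then obtain i0 A0 where i0: "i0 \<in> ?J" "A0 \<in> G i0" "\<not> {1..Suc d} \<subseteq> A0" by blast
      then have A0: "Suc d \<notin> A0" using c[of i0 A0] by (auto simp: atLeastAtMostSuc_conv)
      have "int (\<Sum>i=1..r. card (G i)) < max (hit_total j 1) (hit_total j ?s)"
        by (rule total_interpolated[OF G j _ d1 ds _ i0(1,2) A0 A1]; (rule comp | rule c); assumption)
      moreover have "hit_total j ?s \<le> int size_bound"
        using hit_total_other_min(1)[OF j] ds d1 by (simp add: size_bound_def)
      ultimately show ?thesis using le by linarith
    qed
  qed
  then show "(\<Sum>i=1..r. card (G i)) \<le> size_bound"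
    and "(\<Sum>i=1..r. card (G i)) = size_bound \<Longrightarrow> stars n {1..r} k G \<or> ?hit" by blast+
qed

end

subsection \<open>Extremal families\<close>

lemma is_star_iff: "is_star n r k F \<longleftrightarrow> stars n {1..r} k F"
  by (simp add: is_star_def stars_def)

context uniformities begin

text \<open>Some family other than the \<open>j\<close>-th has uniformity \<open>k r\<close>, and
  its prescribed size is 1. Its only member is \<open>S\<close>; cross-intersection gives the
  inclusions for the other families and the sizes turn them into equalities.\<close>

lemma is_hitting_of_cards:
  assumes F: "crossing n {1..r} k F" and j: "j \<in> {1..r}" "k j = k 1"
    and cj: "card (F j) + ((n - k r) choose k j) = n choose k j"
    and c: "\<And>i. i \<in> {1..r} - {j} \<Longrightarrow> card (F i) = (n - k r) choose (k i - k r)"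
  shows "is_hitting n r k F"
proof -
  have Fi: "F i \<subseteq> nsets {1..n} (k i)" if "i \<in> {1..r}" for i using F that by (simp add: crossing_def)
  have X: "cross (F i) (F i')" if "i \<in> {1..r}" "i' \<in> {1..r}" "i \<noteq> i'" for i i'
    using F that by (simp add: crossing_def)
  obtain i0 where i0: "i0 \<in> {1..r} - {j}" "k i0 = k r"
  proof (cases "j = r")
    case True
    then have "1 \<in> {1..r} - {j}" using r by auto
    then show thesis using that[of 1] j True by simp
  next
    case False
    then show thesis using that[of r] r_in by auto
  qed
  then have "card (F i0) = 1" using c[OF i0(1)] by simp
  then obtain S where S: "F i0 = {S}" using card_1_singletonE by blast
  have S': "S \<in> nsets {1..n} (k r)" using Fi[of i0] i0 S by auto
  then have S'': "S \<subseteq> {1..n}" "card S = k r" "finite S" by (auto simp: nsets_def)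
  have Fj: "F j = {A \<in> nsets {1..n} (k j). A \<inter> S \<noteq> {}}"
  proof (rule card_subset_eq)
    show "F j \<subseteq> {A \<in> nsets {1..n} (k j). A \<inter> S \<noteq> {}}"
      using X[of j i0] S i0 j Fi[of j] by blast
    show "card (F j) = card {A \<in> nsets {1..n} (k j). A \<inter> S \<noteq> {}}"
      using card_nsets_meeting[of "{1..n}" S "k j"] S'' cj by simp
  qed (simp add: finite_imp_finite_nsets)
  have "F i = {A \<in> nsets {1..n} (k i). S \<subseteq> A}" if i: "i \<in> {1..r} - {j}" for i
  proof (rule card_subset_eq)
    \<comment> \<open>\<open>F j\<close> contains the full star of every point of \<open>S\<close>,
      so each other family lies in all these stars.\<close>
    have "F i \<subseteq> star n (k i) x" if "x \<in> S" for x
    proof (rule star_cross_subset[of n "k j"])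
      show "cross (star n (k j) x) (F i)" using X[of j i] i j that unfolding Fj by blast
    qed (use Fi[of i] i j k_pos pair_le[of j i] that S'' in auto)
    then show "F i \<subseteq> {A \<in> nsets {1..n} (k i). S \<subseteq> A}" using Fi[of i] i by blast
    have "k r \<le> k i" using k_anti[of i r] i by auto
    then show "card (F i) = card {A \<in> nsets {1..n} (k i). S \<subseteq> A}"
      using card_nsets_superset[of "{1..n}" S "k i"] S'' c[OF i] by simp
  qed (simp add: finite_imp_finite_nsets)
  then show ?thesis unfolding is_hitting_def using S' j Fj by blast
qed

lemma total_of_is_star:
  assumes "is_star n r k F"
  shows "(\<Sum>i=1..r. card (F i)) = star_bound n r k"
proof -
  obtain x where "x \<in> {1..n}" "\<And>i. i \<in> {1..r} \<Longrightarrow> F i = star n (k i) x"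
    using assms by (auto simp: is_star_def)
  then show ?thesis unfolding star_bound_def using card_star k_pos by (intro sum.cong) auto
qed

lemma total_of_is_hitting:
  assumes "is_hitting n r k F"
  shows "(\<Sum>i=1..r. card (F i)) = hitting_bound n r k"
proof -
  obtain S j where S: "S \<in> nsets {1..n} (k r)" and j: "j \<in> {1..r}" "k j = k 1"
    and Fj: "F j = {A \<in> nsets {1..n} (k j). A \<inter> S \<noteq> {}}"
    and Fi: "\<forall>i\<in>{1..r} - {j}. F i = {A \<in> nsets {1..n} (k i). S \<subseteq> A}"
    using assms unfolding is_hitting_def by (elim bexE conjE) (rule that; assumption)
  have S': "S \<subseteq> {1..n}" "card S = k r" using S by (auto simp: nsets_def)
  have cj: "int (card (F j)) = int (n choose k j) - int ((n - k r) choose k j)"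
    using card_nsets_meeting[of "{1..n}" S "k j"] S' unfolding Fj by simp
  have ci: "card (F i) = (n - k r) choose (k i - k r)" if "i \<in> {1..r} - {j}" for i
  proof -
    have "k r \<le> k i" using k_anti[of i r] that by auto
    then show ?thesis
      unfolding bspec[OF Fi that] using card_nsets_superset[of "{1..n}" S "k i"] S' by simp
  qed
  have "int (\<Sum>i=1..r. card (F i)) = int (card (F j)) + (\<Sum>i\<in>{1..r} - {j}. int (card (F i)))"
    unfolding of_nat_sum using j by (intro sum.remove) auto
  also have "\<dots> = hit_total j (k r)" using cj ci by (simp add: hit_total_def)
  also have "\<dots> = int (hitting_bound n r k)" using hit_total_cong[OF j(1) r_in(1) j(2)] hit_total_first by simp
  finally show ?thesis by (simp only: of_nat_eq_iff)
qed

theorem total_le_size_bound: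
  assumes F: "crossing n {1..r} k F" and ne: "\<And>i. i \<in> {1..r} \<Longrightarrow> F i \<noteq> {}"
  shows "(\<Sum>i=1..r. card (F i)) \<le> size_bound"
    and "(\<Sum>i=1..r. card (F i)) = size_bound \<longleftrightarrow>
      is_star n r k F \<and> star_bound n r k \<ge> hitting_bound n r k \<or>
      is_hitting n r k F \<and> hitting_bound n r k \<ge> star_bound n r k"
proof -
  obtain a b where ab: "a \<in> {1..r}" "b \<in> {1..r}" "a \<noteq> b" "k a + k b < n" using loose_pair by blast
  obtain G where G: "crossing n {1..r} k G" "\<And>i. i \<in> {1..r} \<Longrightarrow> card (G i) = card (F i)"
    "\<And>i. i \<in> {1..r} \<Longrightarrow> compressed {1..n} (G i)" "stars n {1..r} k G \<Longrightarrow> stars n {1..r} k F"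
    using exists_compressed[OF _ F k_pos pair_le ab] by auto
  have neG: "G i \<noteq> {}" if i: "i \<in> {1..r}" for i
  proof -
    have "F i \<subseteq> nsets {1..n} (k i)" using F i by (simp add: crossing_def)
    then have "finite (F i)" by (rule finite_subset) (simp add: finite_imp_finite_nsets)
    then show ?thesis using ne[OF i] G(2)[OF i] by auto
  qed
  have tot: "(\<Sum>i=1..r. card (G i)) = (\<Sum>i=1..r. card (F i))" using G(2) by simp
  note main = compressed_total[OF G(1) G(3) neG, unfolded tot]
  show "(\<Sum>i=1..r. card (F i)) \<le> size_bound" using main(1) by blast
  have "is_star n r k F \<or> is_hitting n r k F" if "(\<Sum>i=1..r. card (F i)) = size_bound"
    using main(2) that
  proof -
    have "stars n {1..r} k G \<or>
      (\<exists>j\<in>{1..r}. k j = k 1 \<and> card (G j) + ((n - k r) choose k j) = n choose k j \<and>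
        (\<forall>i\<in>{1..r} - {j}. card (G i) = (n - k r) choose (k i - k r)))"
      using main(2) that by blast
    then show ?thesis
    proof
      assume "\<exists>j\<in>{1..r}. k j = k 1 \<and> card (G j) + ((n - k r) choose k j) = n choose k j \<and>
        (\<forall>i\<in>{1..r} - {j}. card (G i) = (n - k r) choose (k i - k r))"
      then obtain j where j: "j \<in> {1..r}" "k j = k 1" "card (G j) + ((n - k r) choose k j) = n choose k j"
        "\<forall>i\<in>{1..r} - {j}. card (G i) = (n - k r) choose (k i - k r)" by blast
      have "is_hitting n r k F"
        by (rule is_hitting_of_cards[OF F j(1,2)]) (use j(3,4) G(2) j(1) in simp_all)
      then show ?thesis ..
    qed (use G(4) is_star_iff in blast)
  qed
  then show "(\<Sum>i=1..r. card (F i)) = size_bound \<longleftrightarrow>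
      is_star n r k F \<and> star_bound n r k \<ge> hitting_bound n r k \<or>
      is_hitting n r k F \<and> hitting_bound n r k \<ge> star_bound n r k"
    using total_of_is_star[of F] total_of_is_hitting[of F] unfolding size_bound_def by linarith
qed

text \<open>For \<open>k r \<ge> 2\<close> the star bound is strictly larger. For
  \<open>k r = 1\<close> the bounds agree, but \<open>S\<close> is a single point and a hitting
  configuration is itself a tuple of stars.\<close>

lemma total_eq_iff_star:
  assumes F: "crossing n {1..r} k F" and ne: "\<And>i. i \<in> {1..r} \<Longrightarrow> F i \<noteq> {}"
    and r3: "3 \<le> r" and n: "k 1 + k 2 = n"
  shows "(\<Sum>i=1..r. card (F i)) = size_bound \<longleftrightarrow> is_star n r k F"
proof (cases "2 \<le> k r")
  case True
  then have "hitting_bound n r k < star_bound n r k" using hitting_less_star r3 n by blast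
  then show ?thesis using total_le_size_bound(2)[OF F ne] by auto
next
  case False
  then have kr: "k r = 1" using k_pos[OF r_in(3)] by simp
  have "int (hitting_bound n r k) = int (star_bound n r k)"
    using hit_total_first hit_total_1[OF r_in(1)] kr by simp
  moreover have "is_star n r k F" if hit: "is_hitting n r k F"
  proof -
    obtain S j where S: "S \<in> nsets {1..n} (k r)" and j: "j \<in> {1..r}"
      and Fj: "F j = {A \<in> nsets {1..n} (k j). A \<inter> S \<noteq> {}}"
      and Fi: "\<forall>i\<in>{1..r} - {j}. F i = {A \<in> nsets {1..n} (k i). S \<subseteq> A}"
      using hit unfolding is_hitting_def by (elim bexE conjE) (rule that; assumption)
    obtain x where x: "S = {x}" "x \<in> {1..n}" using S kr by (auto simp: nsets_def card_1_singleton_iff)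
    have "F i = star n (k i) x" if "i \<in> {1..r}" for i
    proof (cases "i = j")
      case True
      then show ?thesis using Fj x by auto
    next
      case False
      then have "i \<in> {1..r} - {j}" using that by simp
      then show ?thesis unfolding bspec[OF Fi \<open>i \<in> {1..r} - {j}\<close>] x by simp
    qed
    then show ?thesis using x by (auto simp: is_star_def)
  qed
  ultimately show ?thesis using total_le_size_bound(2)[OF F ne] by auto
qed

end

section \<open>The cases without a loose pair, and the final theorem\<close>

lemma bij_betw_complement:
  assumes "n = k + l"
  shows "bij_betw (\<lambda>A. {1..n} - A) (nsets {1..n} k) (nsets {1..n} l)"
proof (rule bij_betwI[where g = "\<lambda>A. {1..n} - A"])
  show "(\<lambda>A. {1..n} - A) \<in> nsets {1..n} k \<rightarrow> nsets {1..n} l"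
    using assms by (auto simp: nsets_def card_Diff_subset)
  show "(\<lambda>A. {1..n} - A) \<in> nsets {1..n} l \<rightarrow> nsets {1..n} k"
    using assms by (auto simp: nsets_def card_Diff_subset)
qed (auto simp: nsets_def)

text \<open>As \<open>n = k + l\<close>, complements of members of \<open>\<B>\<close> are
  \<open>k\<close>-sets, and cross-intersection excludes them from \<open>\<A>\<close>. The strict
  bounds on \<open>card \<B>\<close> reflect that both families are non-empty.\<close>

lemma two_families_complementary:
  assumes A: "\<A> \<subseteq> nsets {1..n} k" "\<A> \<noteq> {}" and B: "\<B> \<subseteq> nsets {1..n} l" "\<B> \<noteq> {}"
    and X: "cross \<A> \<B>" and n: "n = k + l"
  shows "card \<A> + card \<B> \<le> n choose k"
    and "card \<A> + card \<B> = n choose k \<longleftrightarrow>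
      \<A> = nsets {1..n} k - complement_family n \<B> \<and> 0 < card \<B> \<and> card \<B> < n choose l"
proof -
  let ?C = "complement_family n \<B>"
  have bij: "bij_betw (\<lambda>A. {1..n} - A) (nsets {1..n} l) (nsets {1..n} k)"
    using n by (intro bij_betw_complement) simp
  have C: "?C \<subseteq> nsets {1..n} k"
    using B(1) bij_betw_imp_surj_on[OF bij] unfolding complement_family_def by blast
  have cC: "card ?C = card \<B>" unfolding complement_family_def
    using inj_on_subset[OF bij_betw_imp_inj_on[OF bij] B(1)] by (rule card_image)
  have fin: "finite (nsets {1..n} k)" "finite (nsets {1..n} l)" by (simp_all add: finite_imp_finite_nsets)
  have fAB: "finite \<A>" "finite \<B>" "finite ?C" using A B C fin finite_subset by blast+
  have dis: "\<A> \<inter> ?C = {}" using X by (auto simp: complement_family_def)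
  then have sub: "\<A> \<subseteq> nsets {1..n} k - ?C" using A by blast
  have cD: "card (nsets {1..n} k - ?C) = (n choose k) - card \<B>"
    using C fAB cC by (simp add: card_Diff_subset)
  have leB: "card \<B> \<le> n choose k" using card_mono[OF fin(1) C] cC by simp
  have leA: "card \<A> \<le> (n choose k) - card \<B>" using card_mono[OF _ sub] fin cD by simp
  show "card \<A> + card \<B> \<le> n choose k" using leA leB by linarith
  have kl: "n choose l = n choose k" using binomial_symmetric[of l n] n by simp
  have pos: "0 < card \<A>" "0 < card \<B>" using A B fAB by (auto simp: card_gt_0_iff)
  have "card \<A> + card \<B> = n choose k \<longleftrightarrow> card \<A> = card (nsets {1..n} k - ?C)"
    using cD leB by auto
  also have "\<dots> \<longleftrightarrow> \<A> = nsets {1..n} k - ?C"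
    using card_subset_eq[OF _ sub] fin by auto
  finally show "card \<A> + card \<B> = n choose k \<longleftrightarrow>
      \<A> = nsets {1..n} k - ?C \<and> 0 < card \<B> \<and> card \<B> < n choose l"
    using pos leA leB kl by auto
qed

text \<open>A set and its complement lie in at most \<open>r\<close> of the families altogether: if both occur,
  they occur in one family only.\<close>

lemma equal_half_uniformities:
  assumes r: "3 \<le> r" and k: "1 \<le> k"
    and F: "\<And>i. i \<in> {1..r} \<Longrightarrow> F i \<subseteq> nsets {1..2 * k} k"
    and X: "\<And>i j. i \<in> {1..r} \<Longrightarrow> j \<in> {1..r} \<Longrightarrow> i \<noteq> j \<Longrightarrow> cross (F i) (F j)"
  shows "(\<Sum>i=1..r. card (F i)) \<le> r * ((2 * k - 1) choose (k - 1))"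
    and "(\<Sum>i=1..r. card (F i)) = r * ((2 * k - 1) choose (k - 1)) \<longleftrightarrow>
      (\<exists>G. G \<subseteq> nsets {1..2 * k} k \<and> intersecting G \<and> card G = (2 * k - 1) choose (k - 1) \<and>
        (\<forall>i\<in>{1..r}. F i = G))"
proof -
  let ?N = "nsets {1..2 * k} k" and ?c = "(2 * k - 1) choose (k - 1)" and ?co = "\<lambda>A. {1..2 * k} - A"
  define m where "m A = card {i \<in> {1..r}. A \<in> F i}" for A
  have fin: "finite ?N" by (simp add: finite_imp_finite_nsets)
  have bij: "bij_betw ?co ?N ?N" by (rule bij_betw_complement) simp
  have sum: "(\<Sum>i=1..r. card (F i)) = (\<Sum>A\<in>?N. m A)"
  proof -
    have "(\<Sum>i=1..r. card (F i)) = (\<Sum>i=1..r. card {A \<in> ?N. A \<in> F i})"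
      using F by (intro sum.cong refl arg_cong[of _ _ card]) blast
    also have "\<dots> = (\<Sum>A\<in>?N. m A)"
      using sum.swap_restrict[of "{1..r}" ?N "\<lambda>_ _. 1::nat" "\<lambda>i A. A \<in> F i"] fin
      by (simp add: m_def)
    finally show ?thesis .
  qed
  \<comment> \<open>Each set is paired with its complement, so the doubled total is a sum of terms
    bounded by \<open>r\<close>.\<close>
  have "(\<Sum>A\<in>?N. m A) = (\<Sum>A\<in>?N. m (?co A))"
    by (rule sum.reindex_bij_betw[OF bij, symmetric])
  then have twice: "2 * (\<Sum>i=1..r. card (F i)) = (\<Sum>A\<in>?N. m A + m (?co A))"
    unfolding sum by (simp add: sum.distrib)
  have "2 * k choose k = ((2 * k - 1) choose (k - 1)) + ((2 * k - 1) choose k)"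
    using k by (intro choose_reduce_nat) auto
  moreover have "(2 * k - 1) choose k = ?c"
    using binomial_symmetric[of k "2 * k - 1"] k by simp
  ultimately have "card ?N = 2 * ?c" by simp
  then have full: "2 * (r * ?c) = (\<Sum>A\<in>?N. r)" by simp
  have m_le: "m A \<le> r" for A
  proof -
    have "m A \<le> card {1..r}" unfolding m_def by (intro card_mono) auto
    then show ?thesis by simp
  qed
  have both: "m A + m (?co A) \<le> 2" if pos: "0 < m A" "0 < m (?co A)" for A
  proof -
    obtain i where i: "i \<in> {1..r}" "A \<in> F i" using pos(1) by (auto simp: m_def card_gt_0_iff)
    obtain j where j: "j \<in> {1..r}" "?co A \<in> F j" using pos(2) by (auto simp: m_def card_gt_0_iff)
    have eq: "i' = j'" if "i' \<in> {1..r}" "j' \<in> {1..r}" "A \<in> F i'" "?co A \<in> F j'" for i' j'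
      using X[OF that(1,2)] that(3,4) by blast
    have "{i' \<in> {1..r}. A \<in> F i'} \<subseteq> {j}" "{j' \<in> {1..r}. ?co A \<in> F j'} \<subseteq> {i}"
      using eq i j by blast+
    then have "m A \<le> card {j}" "m (?co A) \<le> card {i}" unfolding m_def by (intro card_mono; simp)+
    then show ?thesis by simp
  qed
  have le: "m A + m (?co A) \<le> r" for A
    using both[of A] m_le[of A] m_le[of "?co A"] r by linarith
  have "2 * (\<Sum>i=1..r. card (F i)) \<le> 2 * (r * ?c)" unfolding twice full by (rule sum_mono) (rule le)
  then show "(\<Sum>i=1..r. card (F i)) \<le> r * ?c" by simp
  show "(\<Sum>i=1..r. card (F i)) = r * ?c \<longleftrightarrow>
      (\<exists>G. G \<subseteq> ?N \<and> intersecting G \<and> card G = ?c \<and> (\<forall>i\<in>{1..r}. F i = G))"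
  proof
    assume tot: "(\<Sum>i=1..r. card (F i)) = r * ?c"
    have "(\<Sum>A\<in>?N. m A + m (?co A)) = (\<Sum>A\<in>?N. r)" using twice full tot by metis
    then have eq: "m A + m (?co A) = r" if "A \<in> ?N" for A
      by (rule sum_mono_inv[OF _ le that fin])
    have all: "A \<in> F j" if "A \<in> F i" "i \<in> {1..r}" "j \<in> {1..r}" for A i j
    proof -
      have pos: "0 < m A" using that by (auto simp: m_def card_gt_0_iff)
      have sum_r: "m A + m (?co A) = r" using eq F that by blast
      \<comment> \<open>If both sets occurred, \<open>m A + m (?co A)\<close> would be at most 2,
        less than \<open>r\<close>. So \<open>A\<close> has full multiplicity and lies in every
        family.\<close>
      have "\<not> 0 < m (?co A)"
      proof
        assume "0 < m (?co A)"
        then show False using both[OF pos] sum_r r by linarith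
      qed
      then have "m A = card {1..r}" using sum_r by simp
      then have "card {i \<in> {1..r}. A \<in> F i} = card {1..r}" unfolding m_def .
      then have "{i \<in> {1..r}. A \<in> F i} = {1..r}" by (intro card_subset_eq) auto
      then show ?thesis using that by blast
    qed
    have one: "1 \<in> {1..r}" "2 \<in> {1..r}" using r by auto
    then have same: "\<forall>i\<in>{1..r}. F i = F 1" using all by blast
    have "intersecting (F 1)" unfolding intersecting_def
    proof (intro ballI)
      fix A B assume AB: "A \<in> F 1" "B \<in> F 1"
      then have "A \<inter> B \<noteq> {}" using X[OF one] all[OF AB(2) one] by auto
      moreover have "finite (A \<inter> B)" using AB(1) F[OF one(1)] by (auto simp: nsets_def)
      ultimately show "1 \<le> card (A \<inter> B)" by (simp add: Suc_le_eq card_gt_0_iff)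
    qed
    moreover have "card (F 1) = ?c"
    proof -
      have "(\<Sum>i=1..r. card (F i)) = (\<Sum>i=1..r. card (F 1))"
        by (intro sum.cong refl arg_cong[of _ _ card]) (rule bspec[OF same])
      then show ?thesis using tot r by simp
    qed
    ultimately show "\<exists>G. G \<subseteq> ?N \<and> intersecting G \<and> card G = ?c \<and> (\<forall>i\<in>{1..r}. F i = G)"
      using same F[OF one(1)] by (intro exI[of _ "F 1"] conjI)
  next
    assume "\<exists>G. G \<subseteq> ?N \<and> intersecting G \<and> card G = ?c \<and> (\<forall>i\<in>{1..r}. F i = G)"
    then show "(\<Sum>i=1..r. card (F i)) = r * ?c" by auto
  qed
qed

text \<open>Stars and hitting configurations each attain only their own term of the maximum, whence
  the comparisons of the two bounds in the last clause. When \<open>n = k 1 + k r\<close>, the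
  hypotheses give \<open>k 2 = k r\<close>, so exactly one of the three implications has a true
  premise.\<close>

theorem theorem1p7:
  fixes n r :: nat and k :: "nat \<Rightarrow> nat" and F :: "nat \<Rightarrow> nat set set"
  assumes "r \<ge> 2" and "n \<ge> 1"
    and "\<forall>i\<in>{1..r}. k i \<ge> 1"
    and "\<forall>i\<in>{1..r}. F i \<subseteq> nsets {1..n} (k i)"
    and "\<forall>i\<in>{1..r}. F i \<noteq> {}"
    and "cross_intersecting r F"
    and "antimono_on {1..r} k"
    and "n \<ge> k 1 + k 2"
  shows "(\<Sum>i=1..r. card (F i)) \<le> max (hitting_bound n r k) (star_bound n r k) \<and>
    ((\<Sum>i=1..r. card (F i)) = max (hitting_bound n r k) (star_bound n r k) \<longleftrightarrow>
      (n = k 1 + k r \<longrightarrow>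
        (r = 2 \<longrightarrow>
          F 1 = nsets {1..n} (k 1) - complement_family n (F 2) \<and>
          0 < card (F 2) \<and> card (F 2) < n choose k 2) \<and>
        (r > 2 \<and> k 1 > k 2 \<and> (\<forall>i\<in>{2..r}. k i = k 2) \<longrightarrow> is_star n r k F) \<and>
        (r > 2 \<and> (\<forall>i\<in>{1..r}. k i = k 1) \<longrightarrow>
          (\<exists>G. G \<subseteq> nsets {1..n} (k 1) \<and> intersecting G \<and>
            card G = (n - 1) choose (k 1 - 1) \<and> (\<forall>i\<in>{1..r}. F i = G)))) \<and>
      (n > k 1 + k r \<longrightarrow>
        is_star n r k F \<and> star_bound n r k \<ge> hitting_bound n r k \<or>
        is_hitting n r k F \<and> hitting_bound n r k \<ge> star_bound n r k))"
proof -
  note r = assms(1)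
  have kp: "1 \<le> k i" if "i \<in> {1..r}" for i using assms(3) that by blast
  have anti: "k j \<le> k i" if "i \<in> {1..r}" "j \<in> {1..r}" "i \<le> j" for i j
    using assms(7) that by (auto simp: monotone_on_def)
  have Fi: "F i \<subseteq> nsets {1..n} (k i)" if "i \<in> {1..r}" for i using assms(4) that by blast
  have ne: "F i \<noteq> {}" if "i \<in> {1..r}" for i using assms(5) that by blast
  have X: "cross (F i) (F j)" if ij: "i \<in> {1..r}" "j \<in> {1..r}" "i \<noteq> j" for i j
  proof -
    have *: "A \<inter> B \<noteq> {}" if "i \<in> {1..r}" "j \<in> {1..r}" "i < j" "A \<in> F i" "B \<in> F j" for i j A B
      using assms(6) that unfolding cross_intersecting_def by force
    show ?thesis using *[of i j] *[of j i] ij by (cases "i < j") (auto simp: Int_commute)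
  qed
  have crossF: "crossing n {1..r} k F" using Fi X by (simp add: crossing_def)
  have in12: "1 \<in> {1..r}" "2 \<in> {1..r}" "r \<in> {1..r}" using r by auto
  have krn: "k 1 + k r \<le> n" using anti[OF in12(2,3)] r assms(8) by simp
  show ?thesis
  proof (cases "\<exists>a\<in>{1..r}. \<exists>b\<in>{1..r}. a \<noteq> b \<and> k a + k b < n")
    case True
    interpret uniformities n r k
      using r kp anti assms(8) True by unfold_locales auto
    have le: "(\<Sum>i=1..r. card (F i)) \<le> max (hitting_bound n r k) (star_bound n r k)"
      and eq: "(\<Sum>i=1..r. card (F i)) = max (hitting_bound n r k) (star_bound n r k) \<longleftrightarrow>
        is_star n r k F \<and> star_bound n r k \<ge> hitting_bound n r k \<or>
        is_hitting n r k F \<and> hitting_bound n r k \<ge> star_bound n r k"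
      using total_le_size_bound[OF crossF] ne unfolding size_bound_def by blast+
    show ?thesis
    proof (cases "n = k 1 + k r")
      case n: True
      then have k2: "k 2 = k r" "k 1 + k 2 = n" using assms(8) anti[OF in12(2,3)] r by auto
      have ki: "k i = k r" if "i \<in> {2..r}" for i using anti[of 2 i] anti[of i r] that k2 by auto
      obtain a b where ab: "a \<in> {1..r}" "b \<in> {1..r}" "a \<noteq> b" "k a + k b < n" using True by blast
      \<comment> \<open>Since \<open>k 1 + k i = n\<close> for all \<open>i \<ge> 2\<close>, a loose
        pair avoids 1. This gives \<open>r \<ge> 3\<close> and \<open>2 * k r < k 1 + k r\<close>,
        the situation of the second implication.\<close>
      have "a \<noteq> 1" "b \<noteq> 1" using ab n ki[of a] ki[of b] by auto
      then have r3: "3 \<le> r" and k1: "k r < k 1" using ab n ki[of a] ki[of b] by auto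
      have "(\<forall>i\<in>{2..r}. k i = k 2) \<longleftrightarrow> True"
        unfolding simp_thms(12) by (intro ballI) (simp only: ki k2(1))
      moreover have "(\<forall>i\<in>{1..r}. k i = k 1) \<longleftrightarrow> False"
        using k1 in12(3) by (metis less_irrefl)
      moreover have "k 2 < k 1 \<longleftrightarrow> True" "2 < r \<longleftrightarrow> True" "r = 2 \<longleftrightarrow> False"
        "n = k 1 + k r \<longleftrightarrow> True" "k 1 + k r < n \<longleftrightarrow> False"
        using k1 k2(1) r3 n by simp_all
      moreover have "(\<Sum>i=1..r. card (F i)) = max (hitting_bound n r k) (star_bound n r k) \<longleftrightarrow>
          is_star n r k F"
        using total_eq_iff_star[OF crossF _ r3 k2(2)] ne unfolding size_bound_def by blast
      ultimately show ?thesis using le by (simp only: simp_thms) blast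
    next
      case False
      then have "n = k 1 + k r \<longleftrightarrow> False" "k 1 + k r < n \<longleftrightarrow> True" using krn by simp_all
      then show ?thesis using le eq by (simp only: simp_thms)
    qed
  next
    case False
    then have tight: "n \<le> k a + k b" if "a \<in> {1..r}" "b \<in> {1..r}" "a \<noteq> b" for a b
      using that by force
    have n: "n = k 1 + k r" using tight[OF in12(1,3)] krn r by simp
    show ?thesis
    proof (cases "r = 2")
      case r2: True
      have sums: "(\<Sum>i=1..r. card (F i)) = card (F 1) + card (F 2)"
        "star_bound n r k = ((n - 1) choose (k 1 - 1)) + ((n - 1) choose (k 2 - 1))"
        using r2 by (simp_all add: star_bound_def numeral_2_eq_2)
      have n2: "n = k 1 + k 2" using n r2 by simp
      have "hitting_bound n r k = n choose k 1"
        using n2 r2 by (simp add: hitting_bound_def)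
      moreover have "n choose k 1 = ((n - 1) choose (k 1 - 1)) + ((n - 1) choose k 1)"
        using n2 kp[OF in12(1)] by (intro choose_reduce_nat) auto
      moreover have "(n - 1) choose k 1 = (n - 1) choose (k 2 - 1)"
        using binomial_symmetric[of "k 1" "n - 1"] n2 kp[OF in12(2)] by simp
      ultimately have "max (hitting_bound n r k) (star_bound n r k) = n choose k 1"
        using sums(2) by simp
      moreover note two_families_complementary[OF Fi[OF in12(1)] ne[OF in12(1)] Fi[OF in12(2)] ne[OF in12(2)]
            X[OF in12(1,2)] n2]
      moreover have "2 < r \<longleftrightarrow> False" "r = 2 \<longleftrightarrow> True"
        "n = k 1 + k r \<longleftrightarrow> True" "k 1 + k r < n \<longleftrightarrow> False"
        using r2 n by simp_all
      ultimately show ?thesis unfolding sums(1) by (simp only: simp_thms)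
    next
      case r2: False
      then have r3: "3 \<le> r" using r by simp
      \<comment> \<open>The pair \<open>2\<close>, \<open>r\<close> consists of distinct indices and
        is tight, so \<open>k 2 + k r \<ge> n = k 1 + k r\<close>.\<close>
      have "k 1 = k 2" using tight[OF in12(2,3)] r2 n anti[OF in12(1,2)] by simp
      then have k1r: "k 1 = k r" using n assms(8) anti[OF in12(2,3)] r by simp
      have ki: "k i = k 1" if "i \<in> {1..r}" for i using anti[of 1 i] anti[of i r] k1r that by auto
      let ?k = "k 1" and ?c = "(n - 1) choose (k 1 - 1)"
      have n2: "n = 2 * ?k" using n k1r by simp
      have "star_bound n r k = (\<Sum>i=1..r. ?c)"
        unfolding star_bound_def by (intro sum.cong refl) (simp only: ki)
      then have star: "star_bound n r k = r * ?c" by simp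
      have "n choose ?k = ?c + ((n - 1) choose ?k)"
        using n2 kp[OF in12(1)] by (intro choose_reduce_nat) auto
      moreover have "(n - 1) choose ?k = ?c"
        using binomial_symmetric[of ?k "n - 1"] n2 kp[OF in12(1)] by simp
      moreover have "(\<Sum>i=2..r. (n - k r) choose (k i - k r)) = r - 1"
      proof -
        have "(n - k r) choose (k i - k r) = 1" if "i \<in> {2..r}" for i
        proof -
          have "k i = k r" using ki[of i] k1r that by simp
          then show ?thesis by simp
        qed
        then show ?thesis by simp
      qed
      moreover have "(n - k r) choose ?k = 1" using n by simp
      moreover have "1 \<le> ?c" using n2 kp[OF in12(1)] by (simp add: Suc_le_eq)
      moreover from this have "(r - 2) * 1 \<le> (r - 2) * ?c" by (intro mult_le_mono2)
      moreover have "r * ?c = 2 * ?c + (r - 2) * ?c"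
        using r by (metis add_mult_distrib le_add_diff_inverse)
      \<comment> \<open>With \<open>c\<close> for \<open>?c\<close>, the hitting bound is
        \<open>2 * c - 1 + (r - 1)\<close>, which is at most
        \<open>2 * c + (r - 2) * c\<close>.\<close>
      ultimately have "hitting_bound n r k \<le> star_bound n r k"
        using r unfolding hitting_bound_def star by linarith
      then have M: "max (hitting_bound n r k) (star_bound n r k) = r * ?c" using star by simp
      have Fk: "F i \<subseteq> nsets {1..n} ?k" if "i \<in> {1..r}" for i using Fi[OF that] ki[OF that] by simp
      have le: "(\<Sum>i=1..r. card (F i)) \<le> r * ?c"
        and eq: "(\<Sum>i=1..r. card (F i)) = r * ?c \<longleftrightarrow>
          (\<exists>G. G \<subseteq> nsets {1..n} ?k \<and> intersecting G \<and> card G = ?c \<and> (\<forall>i\<in>{1..r}. F i = G))"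
        using equal_half_uniformities[OF r3 kp[OF in12(1)], of F, folded n2] Fk X by blast+
      have "(\<forall>i\<in>{1..r}. k i = k 1) \<longleftrightarrow> True"
        unfolding simp_thms(12) by (intro ballI ki)
      moreover have "k 2 < k 1 \<longleftrightarrow> False" "2 < r \<longleftrightarrow> True" "r = 2 \<longleftrightarrow> False"
        "n = k 1 + k r \<longleftrightarrow> True" "k 1 + k r < n \<longleftrightarrow> False"
        using \<open>k 1 = k 2\<close> r3 n by simp_all
      ultimately show ?thesis unfolding M using le eq by (simp only: simp_thms) blast
    qed
  qed
qed

end
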